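(* Let $\mu$ be a Borel probability measure on $\mathbb{R}$ with $m_1(\mu)=0$, $m_2(\mu)=1$ and $m_4(\mu)<\infty$, where $m_k(\mu)=\int_{\mathbb{R}}x^k\,d\mu(x)$. For $n\ge 1$ let $\mu_n=D_{1/\sqrt{n}}\,\mu^{\uplus n}$. Then for every $n\ge 1$, $$L(\mu_n,\mathbf{b})\le \frac{7}{2}\sqrt[3]{\frac{m_4(\mu)-1}{n}}.$$
   Context: For a Borel probability measure $\mu$ on $\mathbb{R}$ and $a>0$, the dilation $D_a\mu$ is defined by $D_a\mu(B)=\mu(a^{-1}B)$ for Borel $B\subset\mathbb{R}$. The Cauchy transform is $G_\mu(z)=\int_{\mathbb{R}}\frac{1}{z-t}\,d\mu(t)$ for $z\in\mathbb{C}^+$ (open upper half-plane), $F_\mu(z)=1/G_\mu(z)$, and $K_\mu(z)=z-F_\mu(z)$. The Boolean convolution $\mu\uplus\nu$ of probability measures $\mu,\nu$ on $\mathbb{R}$ is the unique probability measure with $K_{\mu\uplus\nu}(z)=K_\mu(z)+K_\nu(z)$ for all $z\in\mathbb{C}^+$; $\mu^{\uplus n}$ is the $n$-fold Boolean convolution of $\mu$ with itself. $\mathbf{b}=\frac12\delta_{-1}+\frac12\delta_1$ is the Bernoulli distribution. The Lévy distance between probability measures $\mu,\nu$ with distribution functions $F,G$ is $L(\mu,\nu)=\inf\{\epsilon>0: F(x-\epsilon)-\epsilon\le G(x)\le F(x+\epsilon)+\epsilon \text{ for all } x\in\mathbb{R}\}$. *)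

theory Defs
  imports "HOL-Probability.Probability"
begin

definition borel_prob :: "real measure \<Rightarrow> bool" where
  "borel_prob \<mu> \<longleftrightarrow> prob_space \<mu> \<and> sets \<mu> = sets borel"

definition cauchy_G :: "real measure \<Rightarrow> complex \<Rightarrow> complex" where
  "cauchy_G \<mu> z = (\<integral>t. 1 / (z - complex_of_real t) \<partial>\<mu>)"

definition cauchy_F :: "real measure \<Rightarrow> complex \<Rightarrow> complex" where
  "cauchy_F \<mu> z = 1 / cauchy_G \<mu> z"

definition cauchy_K :: "real measure \<Rightarrow> complex \<Rightarrow> complex" where
  "cauchy_K \<mu> z = z - cauchy_F \<mu> z"

definition boolean_conv :: "real measure \<Rightarrow> real measure \<Rightarrow> real measure" where
  "boolean_conv \<mu> \<nu> = (THE \<rho>. borel_prob \<rho> \<and>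
      (\<forall>z. 0 < Im z \<longrightarrow> cauchy_K \<rho> z = cauchy_K \<mu> z + cauchy_K \<nu> z))"

text \<open>n-fold Boolean convolution power (meaningful for n \<ge> 1).\<close>
fun boolean_pow :: "real measure \<Rightarrow> nat \<Rightarrow> real measure" where
  "boolean_pow \<mu> 0 = \<mu>"
| "boolean_pow \<mu> (Suc 0) = \<mu>"
| "boolean_pow \<mu> (Suc (Suc n)) = boolean_conv (boolean_pow \<mu> (Suc n)) \<mu>"

definition dilation :: "real \<Rightarrow> real measure \<Rightarrow> real measure" where
  "dilation a \<mu> = distr \<mu> borel (\<lambda>x. a * x)"

definition bernoulli_b :: "real measure" where
  "bernoulli_b = distr (measure_pmf (pmf_of_set {-1, 1::real})) borel (\<lambda>x. x)"

definition distfun :: "real measure \<Rightarrow> real \<Rightarrow> real" where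
  "distfun \<mu> x = measure \<mu> {..x}"

definition levy_dist :: "real measure \<Rightarrow> real measure \<Rightarrow> real" where
  "levy_dist \<mu> \<nu> = Inf {\<epsilon>. 0 < \<epsilon> \<and> (\<forall>x.
      distfun \<mu> (x - \<epsilon>) - \<epsilon> \<le> distfun \<nu> x \<and> distfun \<nu> x \<le> distfun \<mu> (x + \<epsilon>) + \<epsilon>)}"

definition moment :: "nat \<Rightarrow> real measure \<Rightarrow> real" where
  "moment k \<mu> = (\<integral>x. x ^ k \<partial>\<mu>)"

end

theory Submission
  imports Defs "HOL-Complex_Analysis.Complex_Analysis" "HOL-Real_Asymp.Real_Asymp"
begin

text \<open>The Boolean power \<open>\<rho>\<close> with \<open>K\<^sub>\<rho> = n K\<^sub>\<mu>\<close> is obtained as the measure whose Cauchy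
  transform is \<open>1 / (z - n K\<^sub>\<mu>(z))\<close>, a Nevanlinna-type representation proved with the Poisson formula
  and Helly selection; it is unique by Fourier inversion. Expanding \<open>z K\<^sub>\<mu>(z)\<close> along the imaginary axis
  recovers the moments of \<open>\<rho>\<close>, and after dilation \<open>\<mu>\<^sub>n\<close> has mean \<open>0\<close>, variance \<open>1\<close> and
  \<open>\<integral>(x\<^sup>2 - 1)\<^sup>2 d\<mu>\<^sub>n = (m\<^sub>4(\<mu>) - 1) / n\<close>. So \<open>\<mu>\<^sub>n\<close> concentrates near \<open>\<plusminus>1\<close> by Chebyshev, with
  nearly equal masses there because the mean vanishes.\<close>

subsection \<open>Cauchy transforms\<close>

text \<open>\<open>boolean_conv\<close> is a definite description: until a law with the prescribed K
  is exhibited and shown to be unique, nothing can be said about \<open>boolean_pow\<close>. This is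
  why a representation theorem and an injectivity theorem precede every estimate. The second
  obstacle is that a Boolean power obtained in this way comes with no moments, and \<mu> has too few
  of them for a Laurent series at infinity. On the imaginary axis, however, the Cauchy transform
  contains its own cutoff y^2 / (x^2 + y^2), which increases to 1 with y, so convergence of the
  damped even moments forces integrability. Odd moments land in the imaginary part there, so taking
  real parts keeps the third moment, which would give a divergent term, out of the computation. The
  cube root comes from Chebyshev: with \<delta> the mean of (x^2 - 1)^2, the mass far from the two
  atoms is at most \<delta> / \<epsilon>^2, and this has to be at most \<epsilon>.\<close>

lemma borel_prob_iff_real_distribution: "borel_prob M \<longleftrightarrow> real_distribution M"
  by (auto simp: borel_prob_def real_distribution_def real_distribution_axioms_def)

lemma upper_half_diff_real_nonzero:
  assumes "0 < Im z"
  shows "z - complex_of_real t \<noteq> 0"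
  using assms by (auto simp: complex_eq_iff)

lemma cmod_cauchy_kernel_le:
  assumes "0 < Im z"
  shows "cmod (1 / (z - complex_of_real t)) \<le> 1 / Im z"
proof -
  have "Im z \<le> cmod (z - complex_of_real t)"
    using abs_Im_le_cmod[of "z - complex_of_real t"] by simp
  then show ?thesis
    using assms by (simp add: norm_divide frac_le)
qed

lemma cmod_cauchy_kernel_sq:
  "(cmod (1 / (z - complex_of_real t)))\<^sup>2 = 1 / ((t - Re z)\<^sup>2 + (Im z)\<^sup>2)"
  by (simp add: norm_divide power_divide cmod_power2 power2_commute)

lemma Im_cauchy_kernel:
  "Im (1 / (z - complex_of_real t)) = - (Im z / ((t - Re z)\<^sup>2 + (Im z)\<^sup>2))"
  by (simp add: Im_divide power2_commute)

lemma (in real_distribution) integrable_cauchy_kernel: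
  assumes "0 < Im z"
  shows "integrable M (\<lambda>t. 1 / (z - complex_of_real t))"
  by (rule integrable_const_bound[where B = "1 / Im z"])
     (use cmod_cauchy_kernel_le[OF assms] in auto)

lemma (in real_distribution) integrable_poisson_kernel:
  assumes "0 < y"
  shows "integrable M (\<lambda>t. y / ((t - x)\<^sup>2 + y\<^sup>2))"
proof -
  have "integrable M (\<lambda>t. Im (1 / (Complex x y - complex_of_real t)))"
    using integrable_cauchy_kernel[of "Complex x y"] assms by (intro integrable_Im) auto
  then show ?thesis
    by (subst (asm) Im_cauchy_kernel) simp
qed

lemma (in real_distribution) Im_cauchy_G:
  assumes "0 < Im z"
  shows "Im (cauchy_G M z) = - (\<integral>t. Im z / ((t - Re z)\<^sup>2 + (Im z)\<^sup>2) \<partial>M)"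
  unfolding cauchy_G_def
  by (subst integral_Im[symmetric, OF integrable_cauchy_kernel[OF assms]], subst Im_cauchy_kernel) simp

text \<open>Nonnegativity of the variance of |1 / (z - t)|: the squared modulus of the kernel is the
  Poisson kernel divided by Im z, so its mean is - Im G(z) / Im z.\<close>

lemma (in real_distribution) cmod_cauchy_G_sq_le:
  assumes "0 < Im z"
  shows "Im z * (cmod (cauchy_G M z))\<^sup>2 \<le> - Im (cauchy_G M z)"
proof -
  let ?f = "\<lambda>t. cmod (1 / (z - complex_of_real t))"
  have "integrable M (\<lambda>t. (1 / Im z) * (Im z / ((t - Re z)\<^sup>2 + (Im z)\<^sup>2)))"
    by (rule integrable_mult_right[OF integrable_poisson_kernel[OF assms]])
  then have i2: "integrable M (\<lambda>t. (?f t)\<^sup>2)"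
    unfolding cmod_cauchy_kernel_sq using assms by simp
  have i1: "integrable M ?f"
    using integrable_cauchy_kernel[OF assms] by simp
  have "cmod (cauchy_G M z) \<le> expectation ?f"
    unfolding cauchy_G_def by (rule integral_norm_bound)
  then have "(cmod (cauchy_G M z))\<^sup>2 \<le> (expectation ?f)\<^sup>2"
    by (simp add: power_mono)
  also have "\<dots> \<le> expectation (\<lambda>t. (?f t)\<^sup>2)"
    using variance_eq[OF i1 i2] variance_positive[of ?f] by simp
  finally have "Im z * (cmod (cauchy_G M z))\<^sup>2 \<le> Im z * expectation (\<lambda>t. (?f t)\<^sup>2)"
    using assms by (simp add: mult_left_mono)
  also have "\<dots> = expectation (\<lambda>t. Im z / ((t - Re z)\<^sup>2 + (Im z)\<^sup>2))"
    unfolding cmod_cauchy_kernel_sq by (subst integral_mult_right_zero[symmetric]) simp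
  finally show ?thesis
    by (simp add: Im_cauchy_G[OF assms])
qed

lemma (in real_distribution) Im_cauchy_G_neg:
  assumes "0 < Im z"
  shows "Im (cauchy_G M z) < 0"
proof -
  have "(\<integral>t. 0 \<partial>M) < (\<integral>t. Im z / ((t - Re z)\<^sup>2 + (Im z)\<^sup>2) \<partial>M)"
    by (rule integral_less_AE_space)
       (use assms in \<open>auto intro!: integrable_poisson_kernel divide_pos_pos add_nonneg_pos
          simp: emeasure_space_1[simplified]\<close>)
  then show ?thesis
    by (simp add: Im_cauchy_G[OF assms])
qed

lemma (in real_distribution) cauchy_G_nonzero: "0 < Im z \<Longrightarrow> cauchy_G M z \<noteq> 0"
  using Im_cauchy_G_neg[of z] by auto

text \<open>This is what makes Boolean powers possible: z - n K(z) = z + n (F(z) - z) then has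
  imaginary part at least Im z for every n.\<close>

lemma (in real_distribution) Im_cauchy_F_ge:
  assumes "0 < Im z"
  shows "Im z \<le> Im (cauchy_F M z)"
proof -
  have "Im (cauchy_F M z) = - Im (cauchy_G M z) / (cmod (cauchy_G M z))\<^sup>2"
    by (simp add: cauchy_F_def Im_divide cmod_power2)
  then show ?thesis
    using cmod_cauchy_G_sq_le[OF assms] cauchy_G_nonzero[OF assms] by (simp add: pos_le_divide_eq del: minus_divide_left[symmetric])
qed

text \<open>Differentiation under the integral with an explicit remainder: the difference quotient
  of the kernel minus its derivative is (w - z) / ((w - t) (z - t)^2), which is O(|w - z|) uniformly
  in t.\<close>

lemma (in real_distribution) holomorphic_cauchy_G: "cauchy_G M holomorphic_on {z. 0 < Im z}"
proof -
  have "(cauchy_G M has_field_derivative (\<integral>t. - (1 / (z - complex_of_real t)\<^sup>2) \<partial>M)) (at z)"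
    if z: "0 < Im z" for z
  proof -
    let ?k = "\<lambda>z t. 1 / (z - complex_of_real t)"
    let ?D = "\<integral>t. - (?k z t)\<^sup>2 \<partial>M"
    \<comment> \<open>For |w - z| < Im z / 2 one has Im w > Im z / 2, so \<open>C\<close> is the
      product of 2 / Im z, bounding |1 / (w - t)|, and (1 / Im z)^2.\<close>
    define C where "C = 2 / Im z ^ 3"
    have int2: "integrable M (\<lambda>t. - (?k z t)\<^sup>2)"
      using cmod_cauchy_kernel_le[OF z]
      by (intro integrable_const_bound[where B = "(1 / Im z)\<^sup>2"])
         (auto simp: norm_power simp del: power_divide norm_divide intro!: power_mono)
    have bound: "cmod ((cauchy_G M w - cauchy_G M z) / (w - z) - ?D) \<le> C * cmod (w - z)"
      if w: "w \<noteq> z" "dist w z < Im z / 2" for w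
    proof -
      have imw: "Im z / 2 < Im w"
        using w abs_Im_le_cmod[of "w - z"] unfolding dist_norm minus_complex.sel by linarith
      then have imw0: "0 < Im w" using z by linarith
      have "(cauchy_G M w - cauchy_G M z) / (w - z) - ?D
          = (\<integral>t. (?k w t - ?k z t) / (w - z) - - (?k z t)\<^sup>2 \<partial>M)"
        unfolding cauchy_G_def
        using integrable_cauchy_kernel[OF z] integrable_cauchy_kernel[OF imw0] int2
        by (subst Bochner_Integration.integral_diff) auto
      also have "\<dots> = (\<integral>t. (w - z) * (?k w t * (?k z t)\<^sup>2) \<partial>M)"
      proof (rule Bochner_Integration.integral_cong)
        fix t
        have "w - of_real t \<noteq> 0" "z - of_real t \<noteq> 0" "w - z \<noteq> 0"
          using upper_half_diff_real_nonzero z imw0 w by auto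
        note calculation = this
        have "((1 / a - 1 / b) / (a - b) - - (1 / b)\<^sup>2) = (a - b) * ((1 / a) * (1 / b)\<^sup>2)"
          if "a \<noteq> 0" "b \<noteq> 0" "a - b \<noteq> 0" for a b :: complex
          using that by (simp add: divide_simps power2_eq_square) algebra
        from this[of "w - of_real t" "z - of_real t"] calculation
        show "(?k w t - ?k z t) / (w - z) - - (?k z t)\<^sup>2 = (w - z) * (?k w t * (?k z t)\<^sup>2)"
          by simp
      qed simp
      also have "cmod \<dots> \<le> (\<integral>t. C * cmod (w - z) \<partial>M)"
      proof (rule Bochner_Integration.integral_norm_bound_integral)
        have "cmod (?k w t * (?k z t)\<^sup>2) \<le> (2 / Im z) * (1 / Im z)\<^sup>2" for t
        proof -
          have "cmod (?k w t) \<le> 1 / Im w"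
            by (rule cmod_cauchy_kernel_le[OF imw0])
          also have "\<dots> \<le> 2 / Im z"
            using z imw by (simp add: divide_simps)
          finally show ?thesis
            unfolding norm_mult norm_power
            using z by (intro mult_mono power_mono cmod_cauchy_kernel_le) auto
        qed
        also have "(2 / Im z) * (1 / Im z)\<^sup>2 = C"
          by (simp add: C_def power2_eq_square power3_eq_cube)
        finally have b: "cmod (?k w t * (?k z t)\<^sup>2) \<le> C" for t .
        show "cmod ((w - z) * (?k w t * (?k z t)\<^sup>2)) \<le> C * cmod (w - z)" for t
          using mult_right_mono[OF b[of t], of "cmod (w - z)"]
          by (subst mult.commute, subst norm_mult) simp
        show "integrable M (\<lambda>t. (w - z) * (?k w t * (?k z t)\<^sup>2))"
          using b by (intro integrable_mult_right integrable_const_bound[where B = C]) auto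
      qed auto
      also have "\<dots> = C * cmod (w - z)"
        by (simp add: prob_space[simplified])
      finally show ?thesis .
    qed
    have "((\<lambda>w. (cauchy_G M w - cauchy_G M z) / (w - z) - ?D) \<longlongrightarrow> 0) (at z)"
    proof (rule Lim_null_comparison)
      show "\<forall>\<^sub>F w in at z. cmod ((cauchy_G M w - cauchy_G M z) / (w - z) - ?D) \<le> C * cmod (w - z)"
        unfolding eventually_at using z bound by (intro exI[of _ "Im z / 2"]) auto
      show "((\<lambda>w. C * cmod (w - z)) \<longlongrightarrow> 0) (at z)"
        by (auto intro!: tendsto_eq_intros)
    qed
    then show ?thesis
      unfolding has_field_derivative_iff by (subst (asm) Lim_null[symmetric]) (simp add: power_divide)
  qed
  then show ?thesis
    by (auto simp: holomorphic_on_open[OF open_halfspace_Im_gt])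
qed

subsection \<open>The Poisson formula\<close>

lemma has_bochner_integral_poisson_kernel:
  fixes a y :: real
  assumes "0 < y"
  shows "has_bochner_integral lborel (\<lambda>x. y / ((x - a)\<^sup>2 + y\<^sup>2)) pi"
proof -
  have "has_bochner_integral lborel (\<lambda>x::real. inverse (1 + x\<^sup>2)) pi"
    using integrable_inverse_1_plus_square LBINT_inverse_1_plus_square
    by (simp add: has_bochner_integral_iff set_integrable_def interval_lebesgue_integral_def
        set_lebesgue_integral_def)
  then have "has_bochner_integral lborel (\<lambda>x::real. (1 / y) * inverse (1 + x\<^sup>2)) ((1 / y) * pi)"
    by (rule has_bochner_integral_mult_right)
  moreover have "y / ((a + y * x - a)\<^sup>2 + y\<^sup>2) = (1 / y) * inverse (1 + x\<^sup>2)" for x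
    using assms by (simp add: divide_simps add_nonneg_eq_0_iff) (auto simp: power2_eq_square algebra_simps)
  ultimately show ?thesis
    using assms by (subst lborel_has_bochner_integral_real_affine_iff[of y _ _ a]) (auto simp: divide_inverse mult.commute)
qed

text \<open>Under the Poisson integral, \<open>f(w)\<close> is \<open>f(w) - f(z)\<close> plus the constant \<open>f(z)\<close>: the first part has a
  removable singularity and decays like \<open>1/|w|\<^sup>2\<close>, so Cauchy's theorem on a half disc gives \<open>0\<close>
  without any winding number.\<close>

lemma poisson_formula:
  fixes f :: "complex \<Rightarrow> complex" and z :: complex
  assumes s: "0 < s" and holf: "f holomorphic_on {w. - s < Im w}"
    and bound: "\<And>w. 0 \<le> Im w \<Longrightarrow> cmod (f w) \<le> B"
    and z: "0 < Im z"
  shows "has_bochner_integral lborel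
           (\<lambda>x. complex_of_real (Im z / ((x - Re z)\<^sup>2 + (Im z)\<^sup>2)) * f (of_real x)) (pi * f z)"
proof -
  define k where "k x = Im z / ((x - Re z)\<^sup>2 + (Im z)\<^sup>2)" for x
  define h where "h x = complex_of_real (k x) * (f (of_real x) - f z)" for x :: real
  \<comment> \<open>\<open>S\<close> is cut so that it stays inside the domain of \<open>f\<close>
    and above \<open>cnj z\<close>, the only remaining pole of \<open>H\<close>, yet contains the
    closed upper half-plane.\<close>
  define S where "S = {w. - min s (Im z) < Im w}"
  define H where "H w = Im z * (if w = z then deriv f z else (f w - f z) / (w - z)) / (w - cnj z)" for w
  have B: "0 \<le> B"
    using bound[of z] z norm_ge_zero[of "f z"] by linarith
  have kint: "integrable lborel k" and kval: "integral\<^sup>L lborel k = pi"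
    using has_bochner_integral_poisson_kernel[OF z, of "Re z"]
    by (auto simp: has_bochner_integral_iff k_def[abs_def])
  have kpos: "0 \<le> k x" for x
    using z by (auto simp: k_def intro!: divide_nonneg_nonneg)
  have openS: "open S" and convS: "convex S"
    by (simp_all add: S_def open_halfspace_Im_gt convex_halfspace_Im_gt)
  have "f holomorphic_on S"
    by (rule holomorphic_on_subset[OF holf]) (auto simp: S_def)
  then have "(\<lambda>w. if w = z then deriv f z else (f w - f z) / (w - z)) holomorphic_on S"
    using openS by (rule pole_lemma_open)
  then have holH: "H holomorphic_on S"
    unfolding H_def by (intro holomorphic_intros) (auto simp: S_def complex_eq_iff)
  have Hreal: "H (of_real x) = h x" for x
  proof -
    have nz: "of_real x - z \<noteq> 0" "of_real x - cnj z \<noteq> 0"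
      using z by (auto simp: complex_eq_iff)
    have "(of_real x - z) * (of_real x - cnj z) = of_real ((x - Re z)\<^sup>2 + (Im z)\<^sup>2)"
      by (simp add: complex_eq_iff power2_eq_square algebra_simps)
    then have "H (of_real x) = Im z * (f (of_real x) - f z) / of_real ((x - Re z)\<^sup>2 + (Im z)\<^sup>2)"
      using nz by (simp add: H_def)
    then show ?thesis
      by (simp add: h_def k_def)
  qed
  have cont: "continuous_on UNIV (\<lambda>x::real. f (of_real x))"
    by (rule continuous_on_compose2[OF holomorphic_on_imp_continuous_on[OF holf]])
       (use s in \<open>auto intro!: continuous_intros\<close>)
  then have [measurable]: "(\<lambda>x::real. f (of_real x)) \<in> borel_measurable borel"
    by (rule borel_measurable_continuous_onI)
  have [measurable]: "k \<in> borel_measurable borel"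
    unfolding k_def by measurable
  have hb: "cmod (h x) \<le> 2 * B * k x" for x
  proof -
    have "cmod (f (of_real x) - f z) \<le> 2 * B"
      using norm_triangle_ineq4[of "f (of_real x)" "f z"] bound[of "of_real x"] bound[of z] z by simp
    from mult_right_mono[OF this kpos[of x]] show ?thesis
      using kpos[of x] by (simp add: h_def norm_mult mult_ac)
  qed
  have hint: "integrable lborel h"
  proof (rule Bochner_Integration.integrable_bound)
    show "integrable lborel (\<lambda>x. 2 * B * k x)"
      using kint by simp
    show "h \<in> borel_measurable lborel"
      unfolding h_def by measurable
    show "AE x in lborel. norm (h x) \<le> norm (2 * B * k x)"
      using hb by (intro always_eventually allI) (smt (verit) real_norm_def)
  qed
  \<comment> \<open>The segment \<open>l\<close> and the upper semicircle \<open>g\<close> close up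
    to a loop in \<open>S\<close>. On the arc \<open>H\<close> is O(1 / R^2) and the length is pi R,
    so the integral over the segment is O(1 / R).\<close>
  have small: "cmod (\<integral>x. indicator {- R..R} x *\<^sub>R h x \<partial>lborel) \<le> Im z * (2 * B) / (R - cmod z)\<^sup>2 * R * pi"
    if R: "cmod z < R" for R
  proof -
    have R0: "0 < R" using R norm_ge_zero[of z] by linarith
    define g where "g = part_circlepath 0 R 0 pi"
    define l where "l = linepath (complex_of_real (- R)) (complex_of_real R)"
    have Im_g: "0 \<le> Im w" if "w \<in> path_image g" for w
      using that R0 sin_ge_zero
      by (auto simp: g_def path_image_part_circlepath Im_exp)
    have cmod_g: "cmod w = R" if "w \<in> path_image g" for w
      using that R0 by (auto simp: g_def path_image_part_circlepath norm_mult)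
    have S0: "w \<in> S" if "0 \<le> Im w" for w
      using that s z by (auto simp: S_def)
    have ends: "pathstart g = complex_of_real R" "pathfinish g = - complex_of_real R"
      by (simp_all add: g_def)
    have pathg: "path_image g \<subseteq> S"
      using Im_g S0 by blast
    have pathl: "path_image l \<subseteq> S"
    proof
      fix w assume "w \<in> path_image l"
      then have "Im w = 0" by (auto simp: l_def closed_segment_def)
      then show "w \<in> S" using S0 by simp
    qed
    have vl: "valid_path l" and vg: "valid_path g"
      by (simp_all add: l_def g_def)
    have Hc: "continuous_on S H"
      by (rule holomorphic_on_imp_continuous_on[OF holH])
    have ig: "H contour_integrable_on g"
      unfolding g_def
      by (rule contour_integrable_continuous_part_circlepath)
         (use continuous_on_subset[OF Hc pathg] in \<open>simp add: g_def\<close>)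
    have il: "H contour_integrable_on l"
      unfolding l_def
      by (rule contour_integrable_continuous_linepath)
         (use continuous_on_subset[OF Hc pathl] in \<open>simp add: l_def\<close>)
    have "(H has_contour_integral 0) (l +++ g)"
      by (rule Cauchy_theorem_convex_simple[OF holH convS])
         (use vl vg pathl pathg ends in \<open>auto simp: l_def intro!: valid_path_join\<close>,
          auto simp: path_image_join l_def)
    then have "contour_integral l H + contour_integral g H = 0"
      using contour_integral_join[OF il ig vl vg] contour_integral_unique by fastforce
    then have "cmod (contour_integral l H) = cmod (contour_integral g H)"
      by (simp add: add_eq_0_iff)
    also have "\<dots> \<le> (Im z * (2 * B) / (R - cmod z)\<^sup>2) * R * \<bar>pi - 0\<bar>"
      unfolding g_def
    proof (rule contour_integral_bound_part_circlepath)
      show "H contour_integrable_on part_circlepath 0 R 0 pi"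
        using ig by (simp add: g_def)
      show "0 \<le> Im z * (2 * B) / (R - cmod z)\<^sup>2" "0 \<le> R"
        using B R0 z by simp_all
      fix w assume "w \<in> path_image (part_circlepath 0 R 0 pi)"
      then have w: "0 \<le> Im w" "cmod w = R"
        using Im_g cmod_g by (simp_all add: g_def)
      then have wz: "w \<noteq> z" using R by auto
      have 1: "R - cmod z \<le> cmod (w - z)" "R - cmod z \<le> cmod (w - cnj z)"
        using norm_triangle_ineq2[of w z] norm_triangle_ineq2[of w "cnj z"] w by simp_all
      have 2: "cmod (f w - f z) \<le> 2 * B"
        using norm_triangle_ineq4[of "f w" "f z"] bound[of w] bound[of z] z w by simp
      have 3: "(R - cmod z)\<^sup>2 \<le> cmod (w - z) * cmod (w - cnj z)"
        unfolding power2_eq_square using 1 R by (intro mult_mono) auto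
      have "cmod (H w) = Im z * cmod (f w - f z) / (cmod (w - z) * cmod (w - cnj z))"
        using wz z by (simp add: H_def norm_divide norm_mult)
      also have "\<dots> \<le> Im z * (2 * B) / (R - cmod z)\<^sup>2"
        using 2 3 R z B by (intro frac_le mult_left_mono) auto
      finally show "cmod (H w) \<le> Im z * (2 * B) / (R - cmod z)\<^sup>2" .
    qed
    also have "contour_integral l H = integral {- R..R} h"
      unfolding l_def using R0 by (subst contour_integral_linepath_Reals_eq) (auto simp: Hreal)
    also have "\<dots> = (LINT x:{- R..R}|lborel. h x)"
      by (rule set_borel_integral_eq_integral(2)[symmetric])
         (use hint in \<open>simp add: set_integrable_def integrable_mult_indicator\<close>)
    finally show ?thesis
      by (simp add: set_lebesgue_integral_def)
  qed
  have "(\<lambda>n. \<integral>x. indicator {- real n..real n} x *\<^sub>R h x \<partial>lborel) \<longlonglongrightarrow> integral\<^sup>L lborel h"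
  proof (rule integral_dominated_convergence)
    show "integrable lborel (\<lambda>x. norm (h x))" using hint by simp
    show "h \<in> borel_measurable lborel" using hint by simp
    show "AE x in lborel. (\<lambda>n. indicator {- real n..real n} x *\<^sub>R h x) \<longlonglongrightarrow> h x"
    proof (intro always_eventually allI)
      fix x :: real
      have "\<forall>\<^sub>F n in sequentially. indicator {- real n..real n} x *\<^sub>R h x = h x"
        using eventually_ge_at_top[of "nat \<lceil>\<bar>x\<bar>\<rceil>"]
        by eventually_elim (auto split: split_indicator)
      then show "(\<lambda>n. indicator {- real n..real n} x *\<^sub>R h x) \<longlonglongrightarrow> h x"
        by (rule tendsto_eventually)
    qed
  qed (use hint in \<open>auto split: split_indicator\<close>)
  moreover have "(\<lambda>n. \<integral>x. indicator {- real n..real n} x *\<^sub>R h x \<partial>lborel) \<longlonglongrightarrow> 0"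
  proof (rule Lim_null_comparison)
    show "\<forall>\<^sub>F n in sequentially. norm (\<integral>x. indicator {- real n..real n} x *\<^sub>R h x \<partial>lborel)
           \<le> Im z * (2 * B) / (real n - cmod z)\<^sup>2 * real n * pi"
      using eventually_gt_at_top[of "nat \<lceil>cmod z\<rceil>"]
      by eventually_elim (rule small, linarith)
    show "(\<lambda>n. Im z * (2 * B) / (real n - cmod z)\<^sup>2 * real n * pi) \<longlonglongrightarrow> 0"
      by real_asymp
  qed
  ultimately have h0: "integral\<^sup>L lborel h = 0"
    by (rule LIMSEQ_unique)
  have "has_bochner_integral lborel (\<lambda>x. h x + f z * of_real (k x)) (0 + f z * of_real pi)"
    using hint h0 kint kval
    by (intro has_bochner_integral_add has_bochner_integral_mult_right has_bochner_integral_of_real)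
       (auto simp: has_bochner_integral_iff)
  moreover have "h x + f z * of_real (k x) = of_real (k x) * f (of_real x)" for x
    by (simp add: h_def algebra_simps)
  ultimately show ?thesis
    by (simp add: k_def mult.commute)
qed

section \<open>Uniqueness: Fourier transforms on horizontal lines\<close>

lemma integral_iexp_poisson_kernel:
  assumes "0 < y"
  shows "(\<integral>x. iexp (t * x) * of_real (y / ((x - s)\<^sup>2 + y\<^sup>2)) \<partial>lborel)
       = iexp (t * s) * (\<integral>x. iexp (t * y * x) * of_real (1 / (x\<^sup>2 + 1)) \<partial>lborel)"
proof -
  \<comment> \<open>After x = s + y u the centre \<open>s\<close> survives only in the factor
    \<open>iexp (t * s)\<close>, whose mean under a law is its characteristic function.\<close>
  have "(\<integral>x. iexp (t * x) * of_real (y / ((x - s)\<^sup>2 + y\<^sup>2)) \<partial>lborel)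
      = y *\<^sub>R (\<integral>x. iexp (t * (s + y * x)) * of_real (y / ((s + y * x - s)\<^sup>2 + y\<^sup>2)) \<partial>lborel)"
    using assms by (subst lborel_integral_real_affine[of y _ s]) auto
  also have "\<dots> = (\<integral>x. y *\<^sub>R (iexp (t * (s + y * x)) * of_real (y / ((s + y * x - s)\<^sup>2 + y\<^sup>2))) \<partial>lborel)"
    by simp
  also have "\<dots> = (\<integral>x. iexp (t * s) * (iexp (t * y * x) * of_real (1 / (x\<^sup>2 + 1))) \<partial>lborel)"
  proof (rule Bochner_Integration.integral_cong)
    fix x :: real
    have e: "y * (y / ((s + y * x - s)\<^sup>2 + y\<^sup>2)) = 1 / (x\<^sup>2 + 1)"
    proof -
      have "(s + y * x - s)\<^sup>2 + y\<^sup>2 = (y * y) * (x\<^sup>2 + 1)"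
        by (simp add: power2_eq_square algebra_simps)
      then show ?thesis using assms by simp
    qed
    have "y *\<^sub>R (iexp (t * (s + y * x)) * of_real (y / ((s + y * x - s)\<^sup>2 + y\<^sup>2)))
        = iexp (t * (s + y * x)) * of_real (y * (y / ((s + y * x - s)\<^sup>2 + y\<^sup>2)))"
      by (simp only: scaleR_conv_of_real of_real_mult mult_ac)
    also have "\<dots> = iexp (t * s) * (iexp (t * y * x) * of_real (1 / (x\<^sup>2 + 1)))"
      unfolding e by (simp add: exp_add[symmetric] algebra_simps)
    finally show "y *\<^sub>R (iexp (t * (s + y * x)) * of_real (y / ((s + y * x - s)\<^sup>2 + y\<^sup>2)))
        = iexp (t * s) * (iexp (t * y * x) * of_real (1 / (x\<^sup>2 + 1)))" .
  qed simp
  also have "\<dots> = iexp (t * s) * (\<integral>x. iexp (t * y * x) * of_real (1 / (x\<^sup>2 + 1)) \<partial>lborel)"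
    by (rule integral_mult_right_zero)
  finally show ?thesis .
qed

text \<open>Up to a factor, \<open>- Im G\<close> on a horizontal line is the density of the convolution of \<open>M\<close> with a
  Cauchy distribution, so its Fourier transform factors.\<close>

lemma (in real_distribution) integral_iexp_Im_cauchy_G:
  assumes y: "0 < y"
  shows "(\<integral>x. iexp (t * x) * of_real (- Im (cauchy_G M (Complex x y))) \<partial>lborel)
       = char M t * (\<integral>x. iexp (t * y * x) * of_real (1 / (x\<^sup>2 + 1)) \<partial>lborel)"
proof -
  interpret L: pair_sigma_finite M lborel ..
  let ?f = "\<lambda>s x. iexp (t * x) * complex_of_real (y / ((x - s)\<^sup>2 + y\<^sup>2))"
  note k = has_bochner_integral_poisson_kernel[OF y, unfolded has_bochner_integral_iff]
  have nf: "cmod (?f s x) = y / ((x - s)\<^sup>2 + y\<^sup>2)" for s x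
    using y by (simp add: norm_mult del: of_real_divide of_real_add of_real_power)
  have int: "integrable (M \<Otimes>\<^sub>M lborel) (case_prod ?f)"
  proof (rule L.Fubini_integrable)
    show "case_prod ?f \<in> borel_measurable (M \<Otimes>\<^sub>M lborel)"
      by measurable
    show "integrable M (\<lambda>s. \<integral>x. norm (case_prod ?f (s, x)) \<partial>lborel)"
      unfolding prod.case nf using k by simp
    show "AE s in M. integrable lborel (\<lambda>x. case_prod ?f (s, x))"
    proof (intro always_eventually allI)
      fix s
      show "integrable lborel (\<lambda>x. case_prod ?f (s, x))"
      proof (rule Bochner_Integration.integrable_bound)
        show "integrable lborel (\<lambda>x. y / ((x - s)\<^sup>2 + y\<^sup>2))" using k by blast
        show "AE x in lborel. norm (case_prod ?f (s, x)) \<le> norm (y / ((x - s)\<^sup>2 + y\<^sup>2))"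
          unfolding prod.case nf using y by simp
        show "(\<lambda>x. case_prod ?f (s, x)) \<in> borel_measurable lborel"
          unfolding prod.case by measurable
      qed
    qed
  qed
  have "(\<integral>x. iexp (t * x) * of_real (- Im (cauchy_G M (Complex x y))) \<partial>lborel)
      = (\<integral>x. \<integral>s. ?f s x \<partial>M \<partial>lborel)"
  proof (rule Bochner_Integration.integral_cong)
    fix x
    have "- Im (cauchy_G M (Complex x y)) = (\<integral>s. y / ((x - s)\<^sup>2 + y\<^sup>2) \<partial>M)"
      using Im_cauchy_G[of "Complex x y"] y by (simp add: power2_commute[of x])
    then show "iexp (t * x) * of_real (- Im (cauchy_G M (Complex x y))) = (\<integral>s. ?f s x \<partial>M)"
      by (simp only: integral_mult_right_zero integral_complex_of_real)
  qed simp
  also have "\<dots> = (\<integral>s. \<integral>x. ?f s x \<partial>lborel \<partial>M)"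
    by (rule L.Fubini_integral[OF int])
  also have "\<dots> = char M t * (\<integral>x. iexp (t * y * x) * of_real (1 / (x\<^sup>2 + 1)) \<partial>lborel)"
    unfolding integral_iexp_poisson_kernel[OF y] char_def
    by (rule integral_mult_left_zero)
  finally show ?thesis .
qed

theorem cauchy_G_inject:
  assumes "real_distribution M" "real_distribution N"
    and eq: "\<And>z. 0 < Im z \<Longrightarrow> cauchy_G M z = cauchy_G N z"
  shows "M = N"
proof (rule Levy_uniqueness[OF assms(1,2)])
  interpret M: real_distribution M by fact
  interpret N: real_distribution N by fact
  show "char M = char N"
  proof
    fix t
    let ?c = "\<lambda>y. \<integral>x. iexp (t * y * x) * of_real (1 / (x\<^sup>2 + 1)) \<partial>lborel"
    have k: "integrable lborel (\<lambda>x::real. 1 / (x\<^sup>2 + 1))" "(\<integral>x. 1 / (x\<^sup>2 + 1) \<partial>lborel) = pi"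
      using has_bochner_integral_poisson_kernel[of 1 0] by (simp_all add: has_bochner_integral_iff)
    \<comment> \<open>The common factor \<open>?c y\<close> tends to pi as y tends to 0, so it is
      nonzero for some y > 0 and can be cancelled from the two transforms at that height.\<close>
    have "(\<lambda>n. ?c (inverse (real (Suc n)))) \<longlonglongrightarrow> (\<integral>x. of_real (1 / (x\<^sup>2 + 1)) \<partial>lborel)"
    proof (rule integral_dominated_convergence[where w = "\<lambda>x. 1 / (x\<^sup>2 + 1)"])
      show "AE x in lborel. (\<lambda>n. iexp (t * inverse (real (Suc n)) * x) * of_real (1 / (x\<^sup>2 + 1)))
              \<longlonglongrightarrow> complex_of_real (1 / (x\<^sup>2 + 1))"
      proof (intro always_eventually allI)
        fix x :: real
        have "(\<lambda>n. iexp (t * inverse (real (Suc n)) * x) * of_real (1 / (x\<^sup>2 + 1)))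
              \<longlonglongrightarrow> iexp (t * 0 * x) * complex_of_real (1 / (x\<^sup>2 + 1))"
          by (intro tendsto_intros LIMSEQ_inverse_real_of_nat)
        then show "(\<lambda>n. iexp (t * inverse (real (Suc n)) * x) * of_real (1 / (x\<^sup>2 + 1)))
              \<longlonglongrightarrow> complex_of_real (1 / (x\<^sup>2 + 1))" by simp
      qed
      show "AE x in lborel. norm (iexp (t * inverse (real (Suc n)) * x) * of_real (1 / (x\<^sup>2 + 1)))
              \<le> 1 / (x\<^sup>2 + 1)" for n
        by (simp add: norm_mult del: of_real_divide of_real_add of_real_power of_real_mult)
    qed (use k in auto)
    moreover have "(\<integral>x. of_real (1 / (x\<^sup>2 + 1)) \<partial>lborel) = complex_of_real pi"
      using k(2) by (metis integral_complex_of_real)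
    ultimately have "(\<lambda>n. ?c (inverse (real (Suc n)))) \<longlonglongrightarrow> complex_of_real pi"
      by (simp only:)
    then have "\<forall>\<^sub>F n in sequentially. ?c (inverse (real (Suc n))) \<noteq> 0"
      by (rule tendsto_imp_eventually_ne) simp
    then obtain n where n: "?c (inverse (real (Suc n))) \<noteq> 0"
      by (auto simp: eventually_sequentially)
    define y where "y = inverse (real (Suc n))"
    have y: "0 < y" by (simp add: y_def)
    have "char M t * ?c y = char N t * ?c y"
      unfolding M.integral_iexp_Im_cauchy_G[OF y, symmetric] N.integral_iexp_Im_cauchy_G[OF y, symmetric]
      using y by (intro Bochner_Integration.integral_cong) (simp_all add: eq)
    then show "char M t = char N t"
      using n by (simp add: y_def)
  qed
qed

subsection \<open>Representation of Cauchy transforms\<close>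

lemma (in real_distribution) cmod_cauchy_G_le:
  assumes "0 < Im z"
  shows "cmod (cauchy_G M z) \<le> 1 / Im z"
proof -
  have "cmod (cauchy_G M z) \<le> (\<integral>t. 1 / Im z \<partial>M)"
    unfolding cauchy_G_def
    by (rule Bochner_Integration.integral_norm_bound_integral)
       (use assms cmod_cauchy_kernel_le integrable_cauchy_kernel in auto)
  then show ?thesis by (simp add: prob_space[simplified])
qed

text \<open>The factor is y times the Poisson kernel of i y, that is, the cutoff that a Cauchy
  transform supplies at height y. Being in [0, 1] and increasing to 1 with y, it suits both
  dominated and monotone convergence.\<close>

lemma damping_factor:
  fixes x y :: real
  assumes "0 < y"
  shows "0 \<le> y\<^sup>2 / (x\<^sup>2 + y\<^sup>2)" "y\<^sup>2 / (x\<^sup>2 + y\<^sup>2) \<le> 1"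
  using assms by (simp_all add: divide_le_eq_1 add_nonneg_pos)

lemma damping_factor_mono:
  fixes x u v :: real
  assumes "0 < u" "u \<le> v"
  shows "u\<^sup>2 / (x\<^sup>2 + u\<^sup>2) \<le> v\<^sup>2 / (x\<^sup>2 + v\<^sup>2)"
proof -
  have "u\<^sup>2 \<le> v\<^sup>2" "0 < u\<^sup>2" "0 < v\<^sup>2"
    using assms by (auto intro!: power_mono)
  moreover have "a / (b + a) \<le> c / (b + c)" if "0 \<le> b" "0 < a" "a \<le> c" for a b c :: real
    using that by (simp add: field_simps) (simp add: mult.commute[of a] mult_left_mono)
  ultimately show ?thesis by simp
qed

lemma tendsto_damping_factor:
  fixes x :: real
  shows "((\<lambda>y. y\<^sup>2 / (x\<^sup>2 + y\<^sup>2)) \<longlongrightarrow> 1) at_top"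
  by real_asymp

text \<open>The derivative d satisfies Im (d h) = 0 for every h; h = 1 and h = \<i> give d = 0. It
  serves to pass from equal imaginary parts to equality up to a constant.\<close>

lemma holomorphic_real_valued_constant:
  assumes hol: "f holomorphic_on S" and S: "open S" "convex S"
    and real: "\<And>z. z \<in> S \<Longrightarrow> Im (f z) = 0"
  obtains c where "\<And>z. z \<in> S \<Longrightarrow> f z = c"
proof -
  have "(f has_field_derivative 0) (at z within S)" if z: "z \<in> S" for z
  proof -
    obtain d where d: "(f has_field_derivative d) (at z)"
      using hol S(1) z by (auto simp: holomorphic_on_open)
    then have "((\<lambda>w. Im (f w)) has_derivative (\<lambda>h. Im (d * h))) (at z)"
      by (intro bounded_linear.has_derivative[OF bounded_linear_Im])
         (simp add: has_field_derivative_def)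
    moreover have "((\<lambda>w. Im (f w)) has_derivative (\<lambda>h. 0)) (at z)"
      by (rule has_derivative_transform_within_open[OF _ S(1) z, of "\<lambda>w. 0"]) (auto simp: real)
    ultimately have "(\<lambda>h. Im (d * h)) = (\<lambda>h. 0)"
      by (rule has_derivative_unique)
    then have "Im (d * 1) = 0" "Im (d * \<i>) = 0" by meson+
    then have "d = 0" by (simp add: complex_eq_iff)
    then show ?thesis
      using d by (simp add: has_field_derivative_at_within)
  qed
  with S(2) that show thesis
    by (metis has_field_derivative_zero_constant)
qed

text \<open>The measures with density \<open>- Im G(x + is) / \<pi>\<close> are probability measures and tight as \<open>s \<rightarrow> 0\<close>;
  a weak limit has the right imaginary part, and a real constant is excluded by decay.\<close>

theorem cauchy_transform_representation:
  fixes G :: "complex \<Rightarrow> complex"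
  assumes hol: "G holomorphic_on {z. 0 < Im z}"
    and neg: "\<And>z. 0 < Im z \<Longrightarrow> Im (G z) \<le> 0"
    and bound: "\<And>z. 0 < Im z \<Longrightarrow> cmod (G z) \<le> 1 / Im z"
    and lim: "((\<lambda>y. Complex 0 y * G (Complex 0 y)) \<longlongrightarrow> 1) at_top"
  obtains M where "real_distribution M" "\<And>z. 0 < Im z \<Longrightarrow> cauchy_G M z = G z"
proof -
  have contG: "continuous_on {z. 0 < Im z} G"
    by (rule holomorphic_on_imp_continuous_on[OF hol])
  have limR: "((\<lambda>y. - y * Im (G (Complex 0 y))) \<longlongrightarrow> 1) at_top"
    using tendsto_Re[OF lim] by simp
  define p where "p s x = - Im (G (Complex x s)) / pi" for s x
  have p_nonneg: "0 \<le> p s x" if "0 < s" for s x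
    using neg[of "Complex x s"] that by (simp add: p_def divide_nonpos_nonneg)
  have p_meas: "p s \<in> borel_measurable borel" if "0 < s" for s
  proof -
    have "continuous_on UNIV (\<lambda>x. Complex x s)"
      unfolding Complex_eq by (intro continuous_intros)
    then have "continuous_on UNIV (\<lambda>x. G (Complex x s))"
      by (rule continuous_on_compose2[OF contG]) (use that in auto)
    then have "continuous_on UNIV (p s)"
      unfolding p_def by (intro continuous_intros) auto
    then show ?thesis by (rule borel_measurable_continuous_onI)
  qed
  have poisson: "has_bochner_integral lborel (\<lambda>x. Im z / ((x - Re z)\<^sup>2 + (Im z)\<^sup>2) * p s x)
      (- Im (G (z + \<i> * s)))" if s: "0 < s" and z: "0 < Im z" for s z
  proof -
    let ?k = "\<lambda>x. Im z / ((x - Re z)\<^sup>2 + (Im z)\<^sup>2)"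
    \<comment> \<open>Shifting by \<i> s pushes the boundary of the domain below the real line and
      turns the bound 1 / Im z into the constant 1 / s, as the Poisson formula requires.\<close>
    have "(\<lambda>w. G (w + \<i> * s)) holomorphic_on {w. - s < Im w}"
      by (rule holomorphic_on_compose_gen[OF _ hol, unfolded comp_def]) (auto intro!: holomorphic_intros)
    moreover have "cmod (G (w + \<i> * s)) \<le> 1 / s" if "0 \<le> Im w" for w
    proof -
      have "cmod (G (w + \<i> * s)) \<le> 1 / (Im w + s)"
        using bound[of "w + \<i> * s"] that s by simp
      also have "\<dots> \<le> 1 / s"
        using that s by (intro frac_le) auto
      finally show ?thesis .
    qed
    ultimately have "has_bochner_integral lborel
        (\<lambda>x. of_real (?k x) * G (of_real x + \<i> * s)) (pi * G (z + \<i> * s))"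
      using s z by (intro poisson_formula)
    from has_bochner_integral_mult_right[OF has_bochner_integral_Im[OF this], of "- 1 / pi"]
    show ?thesis
      by (simp add: p_def Complex_eq mult_ac)
  qed
  \<comment> \<open>\<open>u n\<close> times the Poisson integral at \<i> \<open>u n\<close> is the
    integral of \<open>p s\<close> against the damping factor. Its limit is read off from
    \<open>lim\<close>, after correcting for the height \<open>u n + s\<close>, and monotone
    convergence removes the factor.\<close>
  have mass: "has_bochner_integral lborel (p s) 1" if s: "0 < s" for s
  proof -
    define u where "u n = real n + 1" for n
    let ?f = "\<lambda>n x. (u n)\<^sup>2 / (x\<^sup>2 + (u n)\<^sup>2) * p s x"
    have u: "0 < u n" for n by (simp add: u_def)
    have f: "has_bochner_integral lborel (?f n) (- u n * Im (G (Complex 0 (u n + s))))" for n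
      using has_bochner_integral_mult_right[OF poisson[OF s, of "Complex 0 (u n)"], of "u n"] u[of n]
      by (simp add: power2_eq_square Complex_eq algebra_simps)
    have inf: "filterlim (\<lambda>n. u n + s) at_top sequentially"
      unfolding u_def by real_asymp
    have "(\<lambda>n. u n / (u n + s) * (- (u n + s) * Im (G (Complex 0 (u n + s))))) \<longlonglongrightarrow> 1 * 1"
    proof (rule tendsto_mult)
      show "(\<lambda>n. u n / (u n + s)) \<longlonglongrightarrow> 1" unfolding u_def by real_asymp
    qed (rule filterlim_compose[OF limR inf])
    moreover have "u n / (u n + s) * (- (u n + s) * Im (G (Complex 0 (u n + s))))
        = - u n * Im (G (Complex 0 (u n + s)))" for n
    proof -
      have "a / b * (- b * c) = - a * c" if "b \<noteq> 0" for a b c :: real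
        using that by simp
      moreover have "u n + s \<noteq> 0" using u[of n] s by linarith
      ultimately show ?thesis by blast
    qed
    ultimately have "(\<lambda>n. - u n * Im (G (Complex 0 (u n + s)))) \<longlonglongrightarrow> 1"
      by simp
    then have L: "(\<lambda>n. integral\<^sup>L lborel (?f n)) \<longlonglongrightarrow> 1"
      by (simp only: has_bochner_integral_integral_eq[OF f])
    show ?thesis
    proof (rule has_bochner_integral_monotone_convergence[OF _ _ _ L])
      show "integrable lborel (?f n)" for n
        using f by (rule integrable.intros)
      have "(u m)\<^sup>2 / (x\<^sup>2 + (u m)\<^sup>2) \<le> (u n)\<^sup>2 / (x\<^sup>2 + (u n)\<^sup>2)" if "m \<le> n" for m n x
        by (rule damping_factor_mono[OF u]) (use that in \<open>simp add: u_def\<close>)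
      then show "AE x in lborel. mono (\<lambda>n. ?f n x)"
        using p_nonneg[OF s] by (intro always_eventually allI monoI mult_right_mono)
      have "filterlim u at_top sequentially"
        unfolding u_def by real_asymp
      then have "(\<lambda>n. (u n)\<^sup>2 / (x\<^sup>2 + (u n)\<^sup>2)) \<longlonglongrightarrow> 1" for x
        by (rule filterlim_compose[OF tendsto_damping_factor])
      from tendsto_mult_right[OF this] have "(\<lambda>n. ?f n x) \<longlonglongrightarrow> 1 * p s x" for x .
      then show "AE x in lborel. (\<lambda>n. ?f n x) \<longlonglongrightarrow> p s x"
        by simp
      show "p s \<in> borel_measurable lborel" using p_meas[OF s] by simp
    qed
  qed
  define D where "D s = density lborel (\<lambda>x. ennreal (p s x))" for s
  have D: "real_distribution (D s)" if s: "0 < s" for s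
  proof -
    have "(\<integral>\<^sup>+x. ennreal (p s x) \<partial>lborel) = 1"
      using mass[OF s] p_nonneg[OF s]
      by (subst nn_integral_eq_integral) (auto simp: has_bochner_integral_iff)
    then have "prob_space (D s)"
      unfolding D_def using p_meas[OF s] by (intro prob_spaceI) (simp add: emeasure_density)
    then show ?thesis
      by (simp add: real_distribution_def real_distribution_axioms_def D_def)
  qed
  have ImD: "Im (cauchy_G (D s) z) = Im (G (z + \<i> * s))" if s: "0 < s" and z: "0 < Im z" for s z
  proof -
    have "(\<integral>t. Im z / ((t - Re z)\<^sup>2 + (Im z)\<^sup>2) \<partial>D s)
        = (\<integral>t. p s t *\<^sub>R (Im z / ((t - Re z)\<^sup>2 + (Im z)\<^sup>2)) \<partial>lborel)"
      unfolding D_def using p_meas[OF s] p_nonneg[OF s] by (subst integral_density) auto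
    also have "\<dots> = - Im (G (z + \<i> * s))"
      using has_bochner_integral_integral_eq[OF poisson[OF s z]] by (simp add: mult.commute)
    finally show ?thesis
      by (simp add: real_distribution.Im_cauchy_G[OF D[OF s] z])
  qed
  define \<mu> where "\<mu> n = D (inverse (real (Suc n)))" for n
  have \<mu>: "real_distribution (\<mu> n)" for n
    unfolding \<mu>_def by (rule D) simp
  have "tight \<mu>"
    unfolding tight_def
  proof (intro conjI allI impI)
    fix \<epsilon> :: real assume \<epsilon>: "0 < \<epsilon>"
    have "\<forall>\<^sub>F y in at_top. 1 - \<epsilon> / 8 < - y * Im (G (Complex 0 y))"
      using order_tendstoD(1)[OF limR, of "1 - \<epsilon> / 8"] \<epsilon> by simp
    then obtain Y where Y: "1 - \<epsilon> / 8 < - y * Im (G (Complex 0 y))" if "Y \<le> y" for y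
      unfolding eventually_at_top_linorder by blast
    define y where "y = max (max Y 1) (8 / \<epsilon>)"
    have y: "Y \<le> y" "0 < y" "8 / \<epsilon> \<le> y" by (auto simp: y_def)
    have "1 - \<epsilon> < measure (\<mu> n) {- y<..y}" for n
    proof -
      interpret real_distribution "\<mu> n" by (rule \<mu>)
      define s where "s = inverse (real (Suc n))"
      have s: "0 < s" "s \<le> 1" by (auto simp: s_def field_simps)
      \<comment> \<open>The damped mass of \<open>\<mu> n\<close> turns out to be
        \<open>c * R\<close>: \<open>R\<close> is the quantity known to be near 1 at height
        \<open>y + s\<close>, and \<open>c\<close> corrects the height back to \<open>y\<close>.
        Each is at least 1 - \<epsilon> / 8, by the choice of \<open>Y\<close> for \<open>R\<close>
        and by \<open>8 / \<epsilon> \<le> y\<close> and \<open>s \<le> 1\<close> for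
        \<open>c\<close>.\<close>
      define c where "c = y / (y + s)"
      define R where "R = - (y + s) * Im (G (Complex 0 (y + s)))"
      have c: "0 \<le> c" "c \<le> 1" "1 - c \<le> \<epsilon> / 8"
      proof -
        show "0 \<le> c" "c \<le> 1" using y s by (simp_all add: c_def)
        have "1 - c = s / (y + s)" using y s by (simp add: c_def field_simps)
        also have "\<dots> \<le> 1 / y" using y s by (intro frac_le) auto
        also have "\<dots> \<le> \<epsilon> / 8" using y \<epsilon> by (simp add: field_simps)
        finally show "1 - c \<le> \<epsilon> / 8" .
      qed
      have "1 - R \<le> \<epsilon> / 8" using Y[of "y + s"] y s by (simp add: R_def)
      then have "c * (1 - R) \<le> c * (\<epsilon> / 8)" using c(1) by (rule mult_left_mono)
      also have "\<dots> \<le> 1 * (\<epsilon> / 8)" using c \<epsilon> by (intro mult_right_mono) auto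
      finally have cR: "1 - c * R \<le> \<epsilon> / 4" using c(3) by (simp add: algebra_simps)
      have "(\<integral>t. y\<^sup>2 / (t\<^sup>2 + y\<^sup>2) \<partial>\<mu> n) = y * (\<integral>t. y / (t\<^sup>2 + y\<^sup>2) \<partial>\<mu> n)"
        by (subst integral_mult_right_zero[symmetric]) (simp add: power2_eq_square)
      also have "\<dots> = - y * Im (cauchy_G (\<mu> n) (Complex 0 y))"
        using y Im_cauchy_G[of "Complex 0 y"] by simp
      also have "\<dots> = - y * Im (G (Complex 0 (y + s)))"
        using ImD[OF s(1), of "Complex 0 y"] y by (simp add: \<mu>_def s_def Complex_eq algebra_simps)
      also have "\<dots> = c * R"
      proof -
        have "y + s \<noteq> 0" using y s by linarith
        have "a / b * (- b * d) = - a * d" if "b \<noteq> 0" for a b d :: real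
          using that by simp
        from this[OF \<open>y + s \<noteq> 0\<close>, of y] show ?thesis by (simp only: c_def R_def)
      qed
      finally have cR_eq: "(\<integral>t. y\<^sup>2 / (t\<^sup>2 + y\<^sup>2) \<partial>\<mu> n) = c * R" .
      \<comment> \<open>The damping factor is at most 1/2 outside the interval, so the probability
        of the interval is at least 2 c R - 1, hence at least 1 - \<epsilon> / 2.\<close>
      have le: "y\<^sup>2 / (t\<^sup>2 + y\<^sup>2) \<le> 1 / 2 + 1 / 2 * indicator {- y<..y} t" for t
      proof (cases "t \<in> {- y<..y}")
        case True
        then show ?thesis using y by (simp add: divide_le_eq_1 add_nonneg_pos)
      next
        case False
        then have "y\<^sup>2 \<le> t\<^sup>2"
          using y by (intro abs_le_square_iff[THEN iffD1]) auto
        then have "y\<^sup>2 / (t\<^sup>2 + y\<^sup>2) \<le> 1 / 2"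
          using y by (simp add: divide_le_eq add_nonneg_pos)
        then show ?thesis using False by simp
      qed
      have "c * R \<le> (\<integral>t. 1 / 2 + 1 / 2 * indicator {- y<..y} t \<partial>\<mu> n)"
        unfolding cR_eq[symmetric]
      proof (rule integral_mono[OF _ _ le])
        show "integrable (\<mu> n) (\<lambda>t. y\<^sup>2 / (t\<^sup>2 + y\<^sup>2))"
          by (rule integrable_const_bound[where B = 1])
             (use y in \<open>auto simp: divide_le_eq_1 add_nonneg_pos\<close>)
      qed (auto simp: emeasure_eq_measure)
      also have "\<dots> = 1 / 2 + 1 / 2 * prob {- y<..y}"
        by (simp add: prob_space[simplified] emeasure_eq_measure)
      finally show ?thesis using cR \<epsilon> by linarith
    qed
    then show "\<exists>a b. a < b \<and> (\<forall>n. 1 - \<epsilon> < measure (\<mu> n) {a<..b})"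
      using y by (intro exI[of _ "- y"] exI[of _ y]) auto
  qed (rule \<mu>)
  then obtain r M where r: "strict_mono (r :: nat \<Rightarrow> nat)" and M: "real_distribution M"
    and weak: "weak_conv_m (\<mu> \<circ> id \<circ> r) M"
    using tight_imp_convergent_subsubsequence[of \<mu> id] by (auto simp: strict_mono_id)
  interpret M: real_distribution M by (rule M)
  have ImM: "Im (cauchy_G M z) = Im (G z)" if z: "0 < Im z" for z
  proof -
    have "(\<lambda>n. \<integral>t. 1 / (z - complex_of_real t) \<partial>(\<mu> \<circ> id \<circ> r) n) \<longlonglongrightarrow> (\<integral>t. 1 / (z - complex_of_real t) \<partial>M)"
      by (rule weak_conv_imp_integral_bdd_continuous_conv[OF _ M weak, where B = "1 / Im z"])
         (use \<mu> upper_half_diff_real_nonzero[OF z] cmod_cauchy_kernel_le[OF z] in \<open>auto intro!: continuous_intros\<close>)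
    from tendsto_Im[OF this]
    have "(\<lambda>n. Im (cauchy_G (\<mu> (r n)) z)) \<longlonglongrightarrow> Im (cauchy_G M z)"
      by (simp add: cauchy_G_def)
    moreover have "Im (cauchy_G (\<mu> (r n)) z) = Im (G (z + \<i> * complex_of_real (inverse (real (Suc (r n))))))" for n
      unfolding \<mu>_def by (rule ImD[OF _ z]) simp
    moreover have "(\<lambda>n. Im (G (z + \<i> * complex_of_real (inverse (real (Suc (r n))))))) \<longlonglongrightarrow> Im (G z)"
    proof -
      have "isCont G z"
        using contG z by (simp add: continuous_on_eq_continuous_at open_halfspace_Im_gt)
      moreover have "(\<lambda>n. z + \<i> * complex_of_real (inverse (real (Suc (r n))))) \<longlonglongrightarrow> z + \<i> * of_real 0"
        by (intro tendsto_intros filterlim_compose[OF LIMSEQ_inverse_real_of_nat]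
              filterlim_subseq r)
      ultimately show ?thesis
        by (intro tendsto_Im isCont_tendsto_compose[of z G]) simp_all
    qed
    ultimately show ?thesis
      by (simp only: LIMSEQ_unique)
  qed
  have "(\<lambda>z. cauchy_G M z - G z) holomorphic_on {z. 0 < Im z}"
    by (intro holomorphic_intros hol M.holomorphic_cauchy_G)
  then obtain d where d: "\<And>z. z \<in> {z. 0 < Im z} \<Longrightarrow> cauchy_G M z - G z = d"
    by (rule holomorphic_real_valued_constant)
       (auto simp: ImM open_halfspace_Im_gt convex_halfspace_Im_gt)
  have le: "cmod d \<le> 2 * inverse (real (Suc n))" for n
  proof -
    let ?z = "Complex 0 (real (Suc n))"
    have "cmod d \<le> cmod (cauchy_G M ?z) + cmod (G ?z)"
      using d[of ?z] norm_triangle_ineq4[of "cauchy_G M ?z" "G ?z"] by simp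
    then show ?thesis
      using M.cmod_cauchy_G_le[of ?z] bound[of ?z] by (simp add: inverse_eq_divide)
  qed
  have "(\<lambda>n. 2 * inverse (real (Suc n))) \<longlonglongrightarrow> 2 * 0"
    by (intro tendsto_intros LIMSEQ_inverse_real_of_nat)
  then have "cmod d \<le> 2 * 0"
    by (rule LIMSEQ_le_const) (use le in blast)
  then have "cauchy_G M z = G z" if "0 < Im z" for z
    using d[of z] that by simp
  with M that show thesis by blast
qed

subsection \<open>Moments and the imaginary axis\<close>

text \<open>For \<open>k\<close> = 1 and \<open>k\<close> = 2 the integrand is bounded for each y >
  0, so these quantities make sense for a law whose moments are not yet known to exist.\<close>

definition damped_moment :: "real measure \<Rightarrow> nat \<Rightarrow> real \<Rightarrow> real" where
  "damped_moment M k y = (\<integral>x. x ^ k * (y\<^sup>2 / (x\<^sup>2 + y\<^sup>2)) \<partial>M)"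

lemma abs_damped_le:
  fixes a x y :: real
  assumes "0 < y"
  shows "\<bar>a * (y\<^sup>2 / (x\<^sup>2 + y\<^sup>2))\<bar> \<le> \<bar>a\<bar>"
  using mult_left_le[OF damping_factor(2)[OF assms, of x] abs_ge_zero[of a]] damping_factor(1)[OF assms, of x]
  by (simp only: abs_mult abs_of_nonneg)

context real_distribution
begin

lemma integrable_power_mono:
  assumes "integrable M (\<lambda>x. x ^ n)" "k \<le> n"
  shows "integrable M (\<lambda>x. x ^ k)"
proof (rule Bochner_Integration.integrable_bound)
  show "integrable M (\<lambda>x. 1 + \<bar>x ^ n\<bar>)"
    using assms by simp
  have "\<bar>x\<bar> ^ k \<le> 1 + \<bar>x\<bar> ^ n" for x :: real
  proof (cases "\<bar>x\<bar> \<le> 1")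
    case True
    then have "\<bar>x\<bar> ^ k \<le> 1" by (simp add: power_le_one)
    then show ?thesis by (smt (verit) zero_le_power abs_ge_zero)
  next
    case False
    then have "\<bar>x\<bar> ^ k \<le> \<bar>x\<bar> ^ n" using assms by (intro power_increasing) auto
    then show ?thesis by simp
  qed
  then show "AE x in M. norm (x ^ k) \<le> norm (1 + \<bar>x ^ n\<bar>)"
    by (simp add: power_abs)
qed simp

lemma integrable_damped:
  assumes "integrable M (\<lambda>x. x ^ k)" "0 < y"
  shows "integrable M (\<lambda>x. x ^ k * (y\<^sup>2 / (x\<^sup>2 + y\<^sup>2)))"
proof (rule Bochner_Integration.integrable_bound[OF assms(1)])
  show "AE x in M. norm (x ^ k * (y\<^sup>2 / (x\<^sup>2 + y\<^sup>2))) \<le> norm (x ^ k)"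
    using abs_damped_le[OF assms(2)] by (simp only: real_norm_def eventually_True)
qed measurable

lemma tendsto_damped_moment:
  assumes "integrable M (\<lambda>x. x ^ k)"
  shows "((\<lambda>y. damped_moment M k y) \<longlongrightarrow> (\<integral>x. x ^ k \<partial>M)) at_top"
  unfolding damped_moment_def
proof (rule integral_dominated_convergence_at_top[where w = "\<lambda>x. \<bar>x ^ k\<bar>"])
  show "integrable M (\<lambda>x. \<bar>x ^ k\<bar>)" using assms by simp
  have "((\<lambda>y. x ^ k * (y\<^sup>2 / (x\<^sup>2 + y\<^sup>2))) \<longlongrightarrow> x ^ k * 1) at_top" for x :: real
    by (rule tendsto_mult_left[OF tendsto_damping_factor])
  then show "AE x in M. ((\<lambda>y. x ^ k * (y\<^sup>2 / (x\<^sup>2 + y\<^sup>2))) \<longlongrightarrow> x ^ k) at_top"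
    by simp
  show "\<forall>\<^sub>F y in at_top. AE x in M. norm (x ^ k * (y\<^sup>2 / (x\<^sup>2 + y\<^sup>2))) \<le> \<bar>x ^ k\<bar>"
    using eventually_gt_at_top[of 0]
    by eventually_elim (use abs_damped_le in \<open>simp only: real_norm_def eventually_True\<close>)
qed measurable

text \<open>The direction that creates moments: for even \<open>k\<close> the damped integrands
  increase to x^k, so a finite limit yields integrability by monotone convergence.\<close>

lemma moment_from_damped_moment:
  assumes k: "even k" and int: "\<And>y. 0 < y \<Longrightarrow> integrable M (\<lambda>x. x ^ k * (y\<^sup>2 / (x\<^sup>2 + y\<^sup>2)))"
    and lim: "((\<lambda>y. damped_moment M k y) \<longlongrightarrow> c) at_top"
  shows "has_bochner_integral M (\<lambda>x. x ^ k) c"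
proof (rule has_bochner_integral_monotone_convergence)
  let ?f = "\<lambda>n x. x ^ k * ((real (Suc n))\<^sup>2 / (x\<^sup>2 + (real (Suc n))\<^sup>2))"
  have suc: "filterlim (\<lambda>n. real (Suc n)) at_top sequentially" by real_asymp
  show "integrable M (?f n)" for n by (rule int) simp
  have "(real (Suc m))\<^sup>2 / (x\<^sup>2 + (real (Suc m))\<^sup>2) \<le> (real (Suc n))\<^sup>2 / (x\<^sup>2 + (real (Suc n))\<^sup>2)"
    if "m \<le> n" for m n and x :: real
    by (rule damping_factor_mono) (use that in simp_all)
  then show "AE x in M. mono (\<lambda>n. ?f n x)"
    using k by (intro always_eventually allI monoI mult_left_mono) (auto simp: zero_le_even_power)
  have "(\<lambda>n. ?f n x) \<longlonglongrightarrow> x ^ k * 1" for x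
    by (rule tendsto_mult_left[OF filterlim_compose[OF tendsto_damping_factor suc]])
  then show "AE x in M. (\<lambda>n. ?f n x) \<longlonglongrightarrow> x ^ k"
    by simp
  show "(\<lambda>n. integral\<^sup>L M (?f n)) \<longlonglongrightarrow> c"
    using filterlim_compose[OF lim suc] by (simp add: damped_moment_def)
qed simp

text \<open>Since 1 - y^2 / (x^2 + y^2) = x^2 / (x^2 + y^2), the fourth moment measures how fast the
  damped second moment converges.\<close>

lemma damped_moment_4:
  assumes "integrable M (\<lambda>x. x\<^sup>2)" "0 < y"
  shows "integrable M (\<lambda>x. x ^ 4 * (y\<^sup>2 / (x\<^sup>2 + y\<^sup>2)))"
    and "damped_moment M 4 y = y\<^sup>2 * ((\<integral>x. x\<^sup>2 \<partial>M) - damped_moment M 2 y)"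
proof -
  have eq: "x ^ 4 * (y\<^sup>2 / (x\<^sup>2 + y\<^sup>2)) = y\<^sup>2 * (x\<^sup>2 - x\<^sup>2 * (y\<^sup>2 / (x\<^sup>2 + y\<^sup>2)))" for x
  proof -
    have "x\<^sup>2 + y\<^sup>2 \<noteq> 0" using assms(2) by (simp add: add_nonneg_eq_0_iff)
    then show ?thesis by (simp add: divide_simps) (simp add: power4_eq_xxxx power2_eq_square algebra_simps)
  qed
  note i = integrable_damped[OF assms]
  show "integrable M (\<lambda>x. x ^ 4 * (y\<^sup>2 / (x\<^sup>2 + y\<^sup>2)))"
    unfolding eq by (intro integrable_mult_right Bochner_Integration.integrable_diff assms(1) i)
  show "damped_moment M 4 y = y\<^sup>2 * ((\<integral>x. x\<^sup>2 \<partial>M) - damped_moment M 2 y)"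
    unfolding damped_moment_def eq
    by (subst integral_mult_right_zero, subst Bochner_Integration.integral_diff[OF assms(1) i]) simp
qed

text \<open>Subtracting the vanishing mean turns the integrand into - x^2 (x y / (x^2 + y^2)). The
  bracket is bounded by 1 and tends to 0, so x^2 dominates and no third moment enters.\<close>

lemma tendsto_damped_moment_1:
  assumes i2: "integrable M (\<lambda>x. x\<^sup>2)" and m1: "(\<integral>x. x \<partial>M) = 0"
  shows "((\<lambda>y. y * damped_moment M 1 y) \<longlongrightarrow> 0) at_top"
proof -
  have i1: "integrable M (\<lambda>x. x)"
    using integrable_power_mono[OF i2, of 1] by simp
  have "((\<lambda>y. \<integral>x. x\<^sup>2 * (x * y / (x\<^sup>2 + y\<^sup>2)) \<partial>M) \<longlongrightarrow> (\<integral>x. 0 \<partial>M)) at_top"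
  proof (rule integral_dominated_convergence_at_top[where w = "\<lambda>x. x\<^sup>2"])
    show "AE x in M. ((\<lambda>y. x\<^sup>2 * (x * y / (x\<^sup>2 + y\<^sup>2))) \<longlongrightarrow> 0) at_top"
    proof (intro always_eventually allI)
      fix x :: real
      show "((\<lambda>y. x\<^sup>2 * (x * y / (x\<^sup>2 + y\<^sup>2))) \<longlongrightarrow> 0) at_top" by real_asymp
    qed
    have "\<bar>x * y\<bar> \<le> x\<^sup>2 + y\<^sup>2" for x y :: real
      using sum_squares_bound[of "\<bar>x\<bar>" "\<bar>y\<bar>"] abs_ge_zero[of "x * y"] unfolding abs_mult power2_abs by linarith
    moreover have "\<bar>a / b\<bar> \<le> 1" if "\<bar>a\<bar> \<le> b" for a b :: real
      using that by (cases "b = 0") (auto simp: abs_divide divide_le_eq_1)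
    ultimately have "\<bar>x * y / (x\<^sup>2 + y\<^sup>2)\<bar> \<le> 1" for x y :: real
      by blast
    from mult_left_mono[OF this zero_le_power2] have "\<bar>x\<^sup>2 * (x * y / (x\<^sup>2 + y\<^sup>2))\<bar> \<le> x\<^sup>2" for x y :: real
      by (simp only: abs_mult abs_power2 mult_1_right)
    then show "\<forall>\<^sub>F y in at_top. AE x in M. norm (x\<^sup>2 * (x * y / (x\<^sup>2 + y\<^sup>2))) \<le> x\<^sup>2"
      by (simp only: real_norm_def eventually_True)
  qed (use i2 in auto)
  then have "((\<lambda>y. - (\<integral>x. x\<^sup>2 * (x * y / (x\<^sup>2 + y\<^sup>2)) \<partial>M)) \<longlongrightarrow> - 0) at_top"
    by (intro tendsto_minus) simp
  moreover have "\<forall>\<^sub>F y in at_top. - (\<integral>x. x\<^sup>2 * (x * y / (x\<^sup>2 + y\<^sup>2)) \<partial>M) = y * damped_moment M 1 y"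
    using eventually_gt_at_top[of 0]
  proof eventually_elim
    case (elim y)
    have eq: "x\<^sup>2 * (x * y / (x\<^sup>2 + y\<^sup>2)) = y * (x - x ^ 1 * (y\<^sup>2 / (x\<^sup>2 + y\<^sup>2)))" for x
    proof -
      have "x\<^sup>2 + y\<^sup>2 \<noteq> 0" using elim by (simp add: add_nonneg_eq_0_iff)
      then show ?thesis by (simp add: divide_simps) (simp add: power2_eq_square algebra_simps)
    qed
    have "integrable M (\<lambda>x. x ^ 1 * (y\<^sup>2 / (x\<^sup>2 + y\<^sup>2)))"
      by (rule integrable_damped) (use i1 elim in auto)
    then show ?case
      unfolding damped_moment_def eq
      by (subst integral_mult_right_zero, subst Bochner_Integration.integral_diff[OF i1]) (auto simp: m1)
  qed
  ultimately show ?thesis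
    by (simp add: Lim_transform_eventually)
qed

text \<open>Pointwise, 1 - \<i> y / (\<i> y - x) = x / (x - \<i> y) = x (x + \<i> y) / (x^2 + y^2);
  even and odd damped moments separate into real and imaginary part.\<close>

lemma cauchy_G_imaginary_axis:
  assumes y: "0 < y"
  shows "complex_of_real (y\<^sup>2) * (1 - Complex 0 y * cauchy_G M (Complex 0 y))
       = Complex (damped_moment M 2 y) (y * damped_moment M 1 y)"
proof -
  let ?z = "Complex 0 y"
  let ?f = "\<lambda>x. complex_of_real (y\<^sup>2) * (1 - ?z * (1 / (?z - complex_of_real x)))"
  have int: "integrable M ?f"
    using integrable_cauchy_kernel[of ?z] y by (intro integrable_mult_right Bochner_Integration.integrable_diff) auto
  have f: "?f x = Complex (x\<^sup>2 * (y\<^sup>2 / (x\<^sup>2 + y\<^sup>2))) (y * (x ^ 1 * (y\<^sup>2 / (x\<^sup>2 + y\<^sup>2))))" for x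
  proof -
    have "x\<^sup>2 + y\<^sup>2 \<noteq> 0" using y by (simp add: add_nonneg_eq_0_iff)
    then show ?thesis
      by (simp add: complex_eq_iff Re_divide Im_divide divide_simps)
         (simp add: power2_eq_square algebra_simps)
  qed
  have "complex_of_real (y\<^sup>2) * (1 - ?z * cauchy_G M ?z) = (\<integral>x. ?f x \<partial>M)"
    unfolding cauchy_G_def
    using integrable_mult_right[OF integrable_cauchy_kernel[of ?z], of ?z] y
    by (subst integral_mult_right_zero, subst Bochner_Integration.integral_diff)
       (simp_all add: prob_space[simplified] del: times_divide_eq_right)
  also have "\<dots> = Complex (\<integral>x. Re (?f x) \<partial>M) (\<integral>x. Im (?f x) \<partial>M)"
    using int by (simp only: complex_eq_iff integral_Re integral_Im complex.sel)
  also have "\<dots> = Complex (damped_moment M 2 y) (y * damped_moment M 1 y)"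
    unfolding f complex.sel damped_moment_def by (subst integral_mult_right_zero) simp
  finally show ?thesis .
qed

lemma integrable_damped_2:
  assumes "0 < y"
  shows "integrable M (\<lambda>x. x\<^sup>2 * (y\<^sup>2 / (x\<^sup>2 + y\<^sup>2)))"
proof (rule integrable_const_bound[where B = "y\<^sup>2"])
  have "\<bar>x\<^sup>2 * (y\<^sup>2 / (x\<^sup>2 + y\<^sup>2))\<bar> \<le> y\<^sup>2" for x
    using damping_factor[OF assms, of x] damping_factor(2)[of "x" y] assms
    by (simp add: divide_le_eq add_nonneg_pos algebra_simps abs_of_nonneg)
  then show "AE x in M. norm (x\<^sup>2 * (y\<^sup>2 / (x\<^sup>2 + y\<^sup>2))) \<le> y\<^sup>2" by simp
qed simp

end

subsection \<open>Boolean powers\<close>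

text \<open>\<open>z K(z)\<close> on the imaginary axis carries the second and fourth moments: it tends to the variance,
  and the next term of its expansion gives the fourth Boolean cumulant.\<close>

definition axis_cumulant :: "real measure \<Rightarrow> real \<Rightarrow> complex" where
  "axis_cumulant M y = Complex 0 y * cauchy_K M (Complex 0 y)"

lemma tendsto_divide_of_real_square:
  fixes A :: "real \<Rightarrow> complex"
  assumes "(A \<longlongrightarrow> a) at_top"
  shows "((\<lambda>y. A y / of_real (y\<^sup>2)) \<longlongrightarrow> 0) at_top"
proof -
  have "((\<lambda>y::real. 1 / y\<^sup>2) \<longlongrightarrow> 0) at_top" by real_asymp
  from tendsto_mult[OF assms tendsto_of_real[OF this]] show ?thesis by simp
qed

context real_distribution
begin

text \<open>With z = \<i> y and w = z G(z), z K(z) = z^2 (1 - 1 / w) = y^2 (1 - w) / w, and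
  \<open>A\<close> is y^2 (1 - w).\<close>

lemma axis_identities:
  assumes y: "0 < y"
  defines "w \<equiv> Complex 0 y * cauchy_G M (Complex 0 y)"
    and "A \<equiv> Complex (damped_moment M 2 y) (y * damped_moment M 1 y)"
  shows "w \<noteq> 0" "w = 1 - A / of_real (y\<^sup>2)" "axis_cumulant M y = A / w"
proof -
  have G: "cauchy_G M (Complex 0 y) \<noteq> 0" using y by (intro cauchy_G_nonzero) simp
  moreover have z: "Complex 0 y \<noteq> 0" using y by (simp add: complex_eq_iff)
  ultimately show w: "w \<noteq> 0" by (simp add: w_def)
  have A: "of_real (y\<^sup>2) * (1 - w) = A"
    unfolding w_def A_def by (rule cauchy_G_imaginary_axis[OF y])
  have y2: "complex_of_real (y\<^sup>2) \<noteq> 0" using y by simp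
  show "w = 1 - A / of_real (y\<^sup>2)"
    using y2 by (simp add: A[symmetric])
  have zz: "Complex 0 y * Complex 0 y = - complex_of_real (y\<^sup>2)"
    by (simp add: complex_eq_iff power2_eq_square)
  have "axis_cumulant M y = Complex 0 y * Complex 0 y * (1 - 1 / w)"
    using G z by (simp add: axis_cumulant_def cauchy_K_def cauchy_F_def w_def right_diff_distrib)
  also have "\<dots> = A / w"
    unfolding zz A[symmetric] using w by (simp add: field_simps)
  finally show "axis_cumulant M y = A / w" .
qed

text \<open>Formally z K(z) = 1 + m3 / z + (m4 - 1) / z^2 + ... . At z = \<i> y the third moment
  contributes an imaginary term of order y to the second quantity, hence the real part.\<close>

lemma axis_cumulant_expansion:
  assumes i4: "integrable M (\<lambda>x. x ^ 4)" and m1: "(\<integral>x. x \<partial>M) = 0" and m2: "(\<integral>x. x\<^sup>2 \<partial>M) = 1"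
  shows "(axis_cumulant M \<longlongrightarrow> 1) at_top"
    and "((\<lambda>y. Re (of_real (y\<^sup>2) * (1 - axis_cumulant M y))) \<longlongrightarrow> (\<integral>x. x ^ 4 \<partial>M) - 1) at_top"
proof -
  have i2: "integrable M (\<lambda>x. x\<^sup>2)" by (rule integrable_power_mono[OF i4]) simp
  define w where "w y = Complex 0 y * cauchy_G M (Complex 0 y)" for y
  define A where "A y = Complex (damped_moment M 2 y) (y * damped_moment M 1 y)" for y
  note id = axis_identities[folded w_def A_def]
  have "(A \<longlongrightarrow> Complex 1 0) at_top"
    unfolding A_def using tendsto_damped_moment[OF i2] tendsto_damped_moment_1[OF i2 m1] m2
    by (intro tendsto_Complex) auto
  then have limA: "(A \<longlongrightarrow> 1) at_top" by (simp add: one_complex.code)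
  have "((\<lambda>y. 1 - A y / of_real (y\<^sup>2)) \<longlongrightarrow> 1 - 0) at_top"
    by (intro tendsto_intros tendsto_divide_of_real_square[OF limA])
  moreover have "\<forall>\<^sub>F y in at_top. 1 - A y / of_real (y\<^sup>2) = w y"
    using eventually_gt_at_top[of 0] by eventually_elim (simp add: id(2))
  ultimately have limw: "(w \<longlongrightarrow> 1) at_top"
    by (simp add: Lim_transform_eventually)
  have "((\<lambda>y. A y / w y) \<longlongrightarrow> 1 / 1) at_top"
    by (intro tendsto_intros limA limw) simp
  moreover have "\<forall>\<^sub>F y in at_top. A y / w y = axis_cumulant M y"
    using eventually_gt_at_top[of 0] by eventually_elim (simp add: id(3))
  ultimately show "(axis_cumulant M \<longlongrightarrow> 1) at_top"
    by (simp add: Lim_transform_eventually)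
  have "((\<lambda>y. damped_moment M 4 y + Re ((1 - A y) * A y / w y) - Re (A y / w y))
          \<longlongrightarrow> (\<integral>x. x ^ 4 \<partial>M) + Re ((1 - 1) * 1 / 1) - Re (1 / 1)) at_top"
    by (intro tendsto_intros limA limw tendsto_damped_moment i4) auto
  moreover have "\<forall>\<^sub>F y in at_top. damped_moment M 4 y + Re ((1 - A y) * A y / w y) - Re (A y / w y)
      = Re (of_real (y\<^sup>2) * (1 - axis_cumulant M y))"
    using eventually_gt_at_top[of 0]
  proof eventually_elim
    case (elim y)
    have y2: "complex_of_real (y\<^sup>2) \<noteq> 0" using elim by simp
    \<comment> \<open>Here a = y^2, b = \<open>A y\<close> and v = \<open>w y\<close>. The identity
      isolates y^2 (1 - A), whose real part is the damped fourth moment; the two other terms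
      converge because \<open>A\<close> and \<open>w\<close> tend to 1.\<close>
    have "a * (1 - b / v) = a * (1 - b) + (1 - b) * b / v - b / v"
      if "a \<noteq> 0" "v \<noteq> 0" "v = 1 - b / a" for a b v :: complex
    proof -
      have "a * (1 - v) = b" using that by simp
      then show ?thesis using that(2) by (simp add: field_simps) algebra
    qed
    from this[OF y2 id(1)[OF elim] id(2)[OF elim]]
    have "of_real (y\<^sup>2) * (1 - axis_cumulant M y)
        = of_real (y\<^sup>2) * (1 - A y) + (1 - A y) * A y / w y - A y / w y"
      by (simp only: id(3)[OF elim])
    moreover have "Re (of_real (y\<^sup>2) * (1 - A y)) = damped_moment M 4 y"
      unfolding damped_moment_4(2)[OF i2 elim] m2 by (simp add: A_def)
    ultimately show ?case by simp
  qed
  ultimately show "((\<lambda>y. Re (of_real (y\<^sup>2) * (1 - axis_cumulant M y))) \<longlongrightarrow> (\<integral>x. x ^ 4 \<partial>M) - 1) at_top"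
    by (simp add: Lim_transform_eventually)
qed

text \<open>A converse to the expansion for a law whose moments are not known to exist: the second
  moment is obtained first and makes the fourth accessible. In the limit, c d is the fourth Boolean
  cumulant and c^2 the square of the variance.\<close>

lemma moments_from_axis_cumulant:
  fixes c d :: real and \<kappa> :: "real \<Rightarrow> complex"
  assumes \<kappa>: "\<And>y. 0 < y \<Longrightarrow> axis_cumulant M y = of_real c * \<kappa> y"
    and lim1: "(\<kappa> \<longlongrightarrow> 1) at_top"
    and lim2: "((\<lambda>y. Re (of_real (y\<^sup>2) * (1 - \<kappa> y))) \<longlongrightarrow> d) at_top"
  shows "(\<integral>x. x \<partial>M) = 0" "has_bochner_integral M (\<lambda>x. x\<^sup>2) c"
    and "has_bochner_integral M (\<lambda>x. x ^ 4) (c * d + c\<^sup>2)"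
proof -
  define w where "w y = Complex 0 y * cauchy_G M (Complex 0 y)" for y
  define A where "A y = Complex (damped_moment M 2 y) (y * damped_moment M 1 y)" for y
  note id = axis_identities[folded w_def A_def]
  have A: "A y = of_real c * \<kappa> y * w y" if "0 < y" for y
    using id(1,3)[OF that] \<kappa>[OF that] by simp
  \<comment> \<open>Eliminating \<open>A\<close> from w = 1 - A / y^2 and A = c \<kappa> w expresses
    w through the known \<kappa> alone.\<close>
  have "((\<lambda>y. 1 / (1 + of_real c * (\<kappa> y / of_real (y\<^sup>2)))) \<longlongrightarrow> 1 / (1 + of_real c * 0)) at_top"
    by (intro tendsto_intros tendsto_divide_of_real_square[OF lim1]) simp
  moreover have "\<forall>\<^sub>F y in at_top. 1 / (1 + of_real c * (\<kappa> y / of_real (y\<^sup>2))) = w y"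
    using eventually_gt_at_top[of 0]
  proof eventually_elim
    case (elim y)
    have "w y * (1 + of_real c * (\<kappa> y / of_real (y\<^sup>2))) = w y + A y / of_real (y\<^sup>2)"
      by (simp add: A[OF elim] algebra_simps)
    also have "\<dots> = 1"
      using id(2)[OF elim] by simp
    finally have eq: "w y * (1 + of_real c * (\<kappa> y / of_real (y\<^sup>2))) = 1" .
    then have "1 + of_real c * (\<kappa> y / of_real (y\<^sup>2)) \<noteq> 0" by auto
    then show ?case
      by (subst nonzero_divide_eq_eq) (simp_all only: eq simp_thms)
  qed
  ultimately have limw: "(w \<longlongrightarrow> 1) at_top"
    by (simp add: Lim_transform_eventually)
  have "((\<lambda>y. of_real c * \<kappa> y * w y) \<longlongrightarrow> of_real c * 1 * 1) at_top"
    by (intro tendsto_intros lim1 limw)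
  moreover have "\<forall>\<^sub>F y in at_top. of_real c * \<kappa> y * w y = A y"
    using eventually_gt_at_top[of 0] by eventually_elim (simp add: A)
  ultimately have limA: "(A \<longlongrightarrow> of_real c) at_top"
    by (simp add: Lim_transform_eventually)
  have "((\<lambda>y. damped_moment M 2 y) \<longlongrightarrow> c) at_top"
    using tendsto_Re[OF limA] by (simp add: A_def)
  from moment_from_damped_moment[OF even_numeral integrable_damped_2 this]
  show m2: "has_bochner_integral M (\<lambda>x. x\<^sup>2) c" .
  from m2 have i2: "integrable M (\<lambda>x. x\<^sup>2)" and e2: "(\<integral>x. x\<^sup>2 \<partial>M) = c"
    by (simp_all add: has_bochner_integral_iff)
  have i1: "integrable M (\<lambda>x. x ^ 1)" by (rule integrable_power_mono[OF i2]) simp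
  have "((\<lambda>y. 1 / y * Im (A y)) \<longlongrightarrow> 0 * Im (of_real c)) at_top"
  proof (intro tendsto_mult tendsto_Im limA)
    show "((\<lambda>y::real. 1 / y) \<longlongrightarrow> 0) at_top" by real_asymp
  qed
  moreover have "\<forall>\<^sub>F y in at_top. 1 / y * Im (A y) = damped_moment M 1 y"
    using eventually_gt_at_top[of 0] by eventually_elim (simp add: A_def)
  ultimately have "((\<lambda>y. damped_moment M 1 y) \<longlongrightarrow> 0) at_top"
    by (simp add: Lim_transform_eventually)
  with tendsto_damped_moment[OF i1] have "(\<integral>x. x ^ 1 \<partial>M) = 0"
    by (intro tendsto_unique[OF trivial_limit_at_top_linorder])
  then show "(\<integral>x. x \<partial>M) = 0" by simp
  have "((\<lambda>y. c * (Re (of_real (y\<^sup>2) * (1 - \<kappa> y)) - Re ((1 - \<kappa> y) * A y) + Re (A y)))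
          \<longlongrightarrow> c * (d - Re ((1 - 1) * of_real c) + Re (of_real c))) at_top"
    by (intro tendsto_intros lim1 lim2 limA)
  moreover have "\<forall>\<^sub>F y in at_top.
      c * (Re (of_real (y\<^sup>2) * (1 - \<kappa> y)) - Re ((1 - \<kappa> y) * A y) + Re (A y)) = damped_moment M 4 y"
    using eventually_gt_at_top[of 0]
  proof eventually_elim
    case (elim y)
    have "complex_of_real (y\<^sup>2) \<noteq> 0" using elim by simp
    then have a: "complex_of_real (y\<^sup>2) * (1 - w y) = A y"
      using id(2)[OF elim] by simp
    \<comment> \<open>This is 1 - \<kappa> w = (1 - \<kappa>) - (1 - \<kappa>) (1 - w) + (1 - w)
      multiplied by c y^2; afterwards y^2 (1 - w) is replaced by the convergent
      \<open>A y\<close>.\<close>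
    have "complex_of_real (y\<^sup>2) * (of_real c - A y)
        = of_real c * (of_real (y\<^sup>2) * (1 - \<kappa> y) - (1 - \<kappa> y) * (of_real (y\<^sup>2) * (1 - w y))
            + of_real (y\<^sup>2) * (1 - w y))"
      unfolding A[OF elim] by (simp add: algebra_simps)
    then have "Re (complex_of_real (y\<^sup>2) * (of_real c - A y))
        = c * (Re (of_real (y\<^sup>2) * (1 - \<kappa> y)) - Re ((1 - \<kappa> y) * A y) + Re (A y))"
      unfolding a by (simp only: Re_complex_of_real complex.sel times_complex.sel minus_complex.sel plus_complex.sel Im_complex_of_real mult_zero_left diff_zero)
    moreover have "Re (complex_of_real (y\<^sup>2) * (of_real c - A y)) = damped_moment M 4 y"
      unfolding damped_moment_4(2)[OF i2 elim] e2 by (simp add: A_def)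
    ultimately show ?case by simp
  qed
  ultimately have "((\<lambda>y. damped_moment M 4 y) \<longlongrightarrow> c * d + c\<^sup>2) at_top"
    by (simp add: Lim_transform_eventually power2_eq_square distrib_left)
  from moment_from_damped_moment[OF even_numeral damped_moment_4(1)[OF i2] this]
  show "has_bochner_integral M (\<lambda>x. x ^ 4) (c * d + c\<^sup>2)" .
qed

text \<open>The candidate Cauchy transform is 1 / H with Im H(z) >= Im z, which gives both the sign
  and the bound. The hypothesis on \<open>axis_cumulant\<close> supplies the normalization, because
  H(z) / z = 1 + n z K(z) / y^2 at z = \<i> y.\<close>

lemma boolean_power_exists:
  assumes lim: "(axis_cumulant M \<longlongrightarrow> 1) at_top" and n: "1 \<le> n"
  obtains N where "real_distribution N" "\<And>z. 0 < Im z \<Longrightarrow> cauchy_K N z = of_nat n * cauchy_K M z"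
proof -
  define H where "H z = z - of_nat n * cauchy_K M z" for z
  have ImH: "Im z \<le> Im (H z)" if "0 < Im z" for z
  proof -
    have "Im (H z) = Im z + (real n * (Im (cauchy_F M z) - Im z))"
      by (simp add: H_def cauchy_K_def algebra_simps)
    then show ?thesis using Im_cauchy_F_ge[OF that] by simp
  qed
  have Hnz: "H z \<noteq> 0" if "0 < Im z" for z
    using ImH[OF that] that by auto
  obtain N where N: "real_distribution N" "\<And>z. 0 < Im z \<Longrightarrow> cauchy_G N z = 1 / H z"
  proof (rule cauchy_transform_representation)
    show "(\<lambda>z. 1 / H z) holomorphic_on {z. 0 < Im z}"
      using Hnz cauchy_G_nonzero unfolding H_def cauchy_K_def cauchy_F_def
      by (intro holomorphic_intros holomorphic_cauchy_G) auto
    show "Im (1 / H z) \<le> 0" if "0 < Im z" for z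
      using ImH[OF that] that by (simp add: Im_divide divide_nonpos_nonneg)
    show "cmod (1 / H z) \<le> 1 / Im z" if "0 < Im z" for z
      using ImH[OF that] that abs_Im_le_cmod[of "H z"] by (simp add: norm_divide frac_le)
    have "((\<lambda>y. 1 / (1 + of_nat n * (axis_cumulant M y / of_real (y\<^sup>2)))) \<longlongrightarrow> 1 / (1 + of_nat n * 0)) at_top"
      by (intro tendsto_intros tendsto_divide_of_real_square[OF lim]) simp
    moreover have "\<forall>\<^sub>F y in at_top. 1 / (1 + of_nat n * (axis_cumulant M y / of_real (y\<^sup>2)))
        = Complex 0 y * (1 / H (Complex 0 y))"
      using eventually_gt_at_top[of 0]
    proof eventually_elim
      case (elim y)
      let ?z = "Complex 0 y"
      have z: "?z \<noteq> 0" using elim by (simp add: complex_eq_iff)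
      have y2: "complex_of_real (y\<^sup>2) = - (?z * ?z)"
        by (simp add: complex_eq_iff power2_eq_square)
      have "1 + of_nat n * (axis_cumulant M y / of_real (y\<^sup>2)) = H ?z / ?z"
        unfolding axis_cumulant_def y2 H_def using z by (simp add: field_simps)
      then show ?case by simp
    qed
    ultimately show "((\<lambda>y. Complex 0 y * (1 / H (Complex 0 y))) \<longlongrightarrow> 1) at_top"
      by (simp add: Lim_transform_eventually)
  qed (rule that)
  show thesis
  proof (rule that[OF N(1)])
    show "cauchy_K N z = of_nat n * cauchy_K M z" if "0 < Im z" for z
      using N(2)[OF that] by (simp add: cauchy_K_def[of N] cauchy_F_def[of N] H_def)
  qed
qed

text \<open>In the induction step the description in \<open>boolean_conv\<close> is resolved by the
  law with (n + 1) K, constructed directly from \<open>M\<close> and not from the previous power;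
  injectivity of the Cauchy transform gives uniqueness.\<close>

lemma boolean_pow_characterization:
  assumes lim: "(axis_cumulant M \<longlongrightarrow> 1) at_top" and n: "1 \<le> n"
  shows "real_distribution (boolean_pow M n) \<and>
    (\<forall>z. 0 < Im z \<longrightarrow> cauchy_K (boolean_pow M n) z = of_nat n * cauchy_K M z)"
  using n
proof (induction n rule: nat_induct_at_least)
  case base
  then show ?case using real_distribution_axioms by simp
next
  case (Suc n)
  obtain N where N: "real_distribution N" "\<And>z. 0 < Im z \<Longrightarrow> cauchy_K N z = of_nat (Suc n) * cauchy_K M z"
    using boolean_power_exists[OF lim, of "Suc n"] by auto
  have K: "cauchy_K (boolean_pow M n) z + cauchy_K M z = of_nat (Suc n) * cauchy_K M z" if "0 < Im z" for z
    using Suc that by (simp add: distrib_right add.commute)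
  have "boolean_pow M (Suc n) = boolean_conv (boolean_pow M n) M"
    using \<open>1 \<le> n\<close> by (cases n) auto
  also have "\<dots> = N"
    unfolding boolean_conv_def borel_prob_iff_real_distribution
  proof (rule the_equality)
    show "real_distribution N \<and> (\<forall>z. 0 < Im z \<longrightarrow> cauchy_K N z = cauchy_K (boolean_pow M n) z + cauchy_K M z)"
      using N K by simp
    fix R assume R: "real_distribution R \<and>
      (\<forall>z. 0 < Im z \<longrightarrow> cauchy_K R z = cauchy_K (boolean_pow M n) z + cauchy_K M z)"
    show "R = N"
    proof (rule cauchy_G_inject)
      fix z :: complex assume z: "0 < Im z"
      then have "cauchy_K R z = cauchy_K N z" using R N K by simp
      then show "cauchy_G R z = cauchy_G N z"
        by (simp add: cauchy_K_def cauchy_F_def)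
    qed (use R N in auto)
  qed
  finally show ?case using N by simp
qed

end

subsection \<open>Distance to the Bernoulli law\<close>

lemma distfun_bernoulli_b:
  "distfun bernoulli_b x = (if x < -1 then 0 else if x < 1 then 1 / 2 else 1)"
proof -
  have "distfun bernoulli_b x = measure (measure_pmf (pmf_of_set {-1, 1::real})) {..x}"
    unfolding distfun_def bernoulli_b_def by (subst measure_distr) auto
  also have "\<dots> = card ({-1, 1} \<inter> {..x}) / card {-1, 1::real}"
    by (rule measure_pmf_of_set) auto
  also have "{-1, 1} \<inter> {..x} = (if x < -1 then {} else if x < 1 then {-1} else {-1, 1})"
    by auto
  finally show ?thesis by auto
qed

text \<open>On \<open>{..1 - \<epsilon>}\<close> the indicator is dominated by a quartic polynomial whose expectation is
  known; the term \<open>\<epsilon>\<^sup>2 / 16\<close> absorbs the linear error near the atoms by completing a square.\<close>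

lemma indicator_le_quartic:
  fixes x \<epsilon> :: real
  assumes \<epsilon>: "0 < \<epsilon>"
  shows "indicator {..1 - \<epsilon>} x \<le> (1 - x) / 2 + (x\<^sup>2 - 1)\<^sup>2 / \<epsilon>\<^sup>2 + \<epsilon>\<^sup>2 / 16"
proof -
  \<comment> \<open>\<open>h\<close> is x + 1 or x - 1, and \<open>k\<close> is the other factor of
    x^2 - 1 up to sign, which is at least 1 in the ranges where this is applied.\<close>
  have key: "h / 2 \<le> (h * k)\<^sup>2 / \<epsilon>\<^sup>2 + \<epsilon>\<^sup>2 / 16" if "1 \<le> k" for h k :: real
  proof -
    have "h\<^sup>2 * 1 \<le> h\<^sup>2 * k\<^sup>2"
      using that by (intro mult_left_mono) (auto simp: one_le_power)
    then have "h\<^sup>2 / \<epsilon>\<^sup>2 \<le> (h * k)\<^sup>2 / \<epsilon>\<^sup>2"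
      using \<epsilon> by (simp add: divide_right_mono power_mult_distrib)
    moreover have "0 \<le> (h / \<epsilon> - \<epsilon> / 4)\<^sup>2" by simp
    then have "h / 2 \<le> h\<^sup>2 / \<epsilon>\<^sup>2 + \<epsilon>\<^sup>2 / 16"
      using \<epsilon> by (simp add: power2_diff power_divide)
    ultimately show ?thesis by linarith
  qed
  have nn: "0 \<le> (x\<^sup>2 - 1)\<^sup>2 / \<epsilon>\<^sup>2" "0 \<le> \<epsilon>\<^sup>2 / 16" by simp_all
  show ?thesis
  proof (cases "x \<le> 1 - \<epsilon>")
    case True
    have eq: "(x + 1) * (1 - x) = 1 - x\<^sup>2" by (simp add: power2_eq_square algebra_simps)
    have "(x + 1) / 2 \<le> (x\<^sup>2 - 1)\<^sup>2 / \<epsilon>\<^sup>2 + \<epsilon>\<^sup>2 / 16"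
    proof (cases "x \<le> 0")
      case True
      then show ?thesis
        using key[of "1 - x" "x + 1"] unfolding eq by (simp add: power2_commute)
    next
      case False
      \<comment> \<open>For 0 < x <= 1 - \<epsilon>, between the atoms, the quartic term alone is
        already at least 1.\<close>
      have "\<epsilon>\<^sup>2 * 1 \<le> (1 - x)\<^sup>2 * (x + 1)\<^sup>2"
        using False True \<epsilon> by (intro mult_mono power_mono) (auto simp: one_le_power)
      also have "\<dots> = (x\<^sup>2 - 1)\<^sup>2"
        by (simp add: power2_eq_square algebra_simps)
      finally have 1: "1 \<le> (x\<^sup>2 - 1)\<^sup>2 / \<epsilon>\<^sup>2"
        using \<epsilon> by simp
      have "(x + 1) / 2 \<le> 1" using True \<epsilon> by simp
      from order_trans[OF this 1] show ?thesis
        using nn(2) by (rule add_increasing2[rotated])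
    qed
    then show ?thesis using True by (simp add: field_simps)
  next
    case False
    have eq: "(x - 1) * (x + 1) = x\<^sup>2 - 1" by (simp add: power2_eq_square algebra_simps)
    have "(x - 1) / 2 \<le> (x\<^sup>2 - 1)\<^sup>2 / \<epsilon>\<^sup>2 + \<epsilon>\<^sup>2 / 16"
    proof (cases "x \<le> 1")
      case True
      then have "(x - 1) / 2 \<le> 0" by simp
      from order_trans[OF this add_nonneg_nonneg[OF nn]] show ?thesis .
    next
      case False
      then show ?thesis
        using key[of "x + 1" "x - 1"] eq by simp
    qed
    then show ?thesis using False by (simp add: field_simps)
  qed
qed

lemma indicator_outside_le:
  fixes x \<epsilon> :: real
  assumes "0 < \<epsilon>"
  shows "indicator {x. 1 + \<epsilon> \<le> \<bar>x\<bar>} x \<le> (x\<^sup>2 - 1)\<^sup>2 / \<epsilon>\<^sup>2"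
proof (cases "1 + \<epsilon> \<le> \<bar>x\<bar>")
  case True
  then have "\<epsilon> * 1 \<le> (\<bar>x\<bar> - 1) * (\<bar>x\<bar> + 1)"
    using assms by (intro mult_mono) auto
  also have "\<dots> = x\<^sup>2 - 1"
    by (simp add: power2_eq_square algebra_simps abs_mult_self_eq)
  finally have "\<epsilon>\<^sup>2 \<le> (x\<^sup>2 - 1)\<^sup>2"
    using assms by (intro power_mono) auto
  then show ?thesis using True assms by simp
qed simp

section \<open>From the first four moments to the Levy distance\<close>

context real_distribution
begin

text \<open>The dominating polynomials below all have this shape; as the mean vanishes, the slope
  \<open>b\<close> does not show in the expectation.\<close>

lemma expectation_quartic:
  assumes i4: "integrable M (\<lambda>x. x ^ 4)" and m1: "expectation (\<lambda>x. x) = 0"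
    and m2: "expectation (\<lambda>x. x\<^sup>2) = 1"
  shows "integrable M (\<lambda>x. (a + b * x) + c * (x\<^sup>2 - 1)\<^sup>2)"
    and "expectation (\<lambda>x. (a + b * x) + c * (x\<^sup>2 - 1)\<^sup>2) = a + c * (expectation (\<lambda>x. x ^ 4) - 1)"
proof -
  have i1: "integrable M (\<lambda>x. x)" and i2: "integrable M (\<lambda>x. x\<^sup>2)"
    using integrable_power_mono[OF i4, of 1] integrable_power_mono[OF i4, of 2] by simp_all
  have eq: "(a + b * x) + c * (x\<^sup>2 - 1)\<^sup>2 = (a + c) + b * x - (2 * c) * x\<^sup>2 + c * x ^ 4" for x :: real
    by (simp add: power2_eq_square power4_eq_xxxx algebra_simps)
  show "integrable M (\<lambda>x. (a + b * x) + c * (x\<^sup>2 - 1)\<^sup>2)"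
    unfolding eq using i1 i2 i4 by simp
  show "expectation (\<lambda>x. (a + b * x) + c * (x\<^sup>2 - 1)\<^sup>2) = a + c * (expectation (\<lambda>x. x ^ 4) - 1)"
    unfolding eq using i1 i2 i4 m1 m2 by (simp add: prob_space[simplified] algebra_simps)
qed

lemma levy_dist_bernoulli_le:
  assumes i4: "integrable M (\<lambda>x. x ^ 4)" and m1: "expectation (\<lambda>x. x) = 0"
    and m2: "expectation (\<lambda>x. x\<^sup>2) = 1" and m4: "expectation (\<lambda>x. x ^ 4) = 1 + \<delta>"
  shows "levy_dist M bernoulli_b \<le> 7 / 2 * root 3 \<delta>"
proof -
  note q = expectation_quartic[OF i4 m1 m2]
  have "0 \<le> expectation (\<lambda>x. 0 + 0 * x + 1 * (x\<^sup>2 - 1)\<^sup>2)"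
    by (intro Bochner_Integration.integral_nonneg) simp
  then have \<delta>: "0 \<le> \<delta>" unfolding q(2) using m4 by simp
  define S where "S = {\<epsilon>. 0 < \<epsilon> \<and> (\<forall>x. distfun M (x - \<epsilon>) - \<epsilon> \<le> distfun bernoulli_b x \<and>
      distfun bernoulli_b x \<le> distfun M (x + \<epsilon>) + \<epsilon>)}"
  have mem: "\<epsilon> \<in> S" if \<epsilon>: "0 < \<epsilon>" "7 / 2 * root 3 \<delta> \<le> \<epsilon>" for \<epsilon>
  proof (cases "1 \<le> \<epsilon>")
    case True
    have "distfun M t \<le> 1" "0 \<le> distfun M t" for t
      by (simp_all add: distfun_def)
    then have "distfun M (x - \<epsilon>) - \<epsilon> \<le> 0" "1 \<le> distfun M (x + \<epsilon>) + \<epsilon>" for x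
      using True by (smt (verit))+
    moreover have "0 \<le> distfun bernoulli_b x" "distfun bernoulli_b x \<le> 1" for x
      by (simp_all add: distfun_bernoulli_b)
    ultimately have "distfun M (x - \<epsilon>) - \<epsilon> \<le> distfun bernoulli_b x \<and>
        distfun bernoulli_b x \<le> distfun M (x + \<epsilon>) + \<epsilon>" for x
      by (meson order_trans)
    then show ?thesis
      unfolding S_def using \<epsilon>(1) by blast
  next
    case False
    \<comment> \<open>The constant 7/2 enters here, giving \<delta> / \<epsilon>^2 <= 8 \<epsilon> /
      343. Added to the square-completion error, at most \<epsilon> / 16 as \<epsilon> < 1, this
      stays well below \<epsilon>.\<close>
    have "\<delta> = (root 3 \<delta>) ^ 3" using \<delta> by (simp add: real_root_pow_pos2)
    also have "\<dots> \<le> (2 / 7 * \<epsilon>) ^ 3"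
      using \<epsilon> \<delta> by (intro power_mono) auto
    finally have "\<delta> / \<epsilon>\<^sup>2 \<le> (2 / 7 * \<epsilon>) ^ 3 / \<epsilon>\<^sup>2"
      by (rule divide_right_mono) simp
    also have "\<dots> = 8 / 343 * \<epsilon>"
      using \<epsilon> by (simp add: power2_eq_square power3_eq_cube)
    finally have d: "(1 / \<epsilon>\<^sup>2) * \<delta> \<le> 8 / 343 * \<epsilon>" by simp
    have e2: "\<epsilon>\<^sup>2 / 16 \<le> \<epsilon> / 16"
      using \<epsilon> False by (simp add: power2_eq_square mult_left_le)
    have le: "prob A \<le> a + c * \<delta>"
      if "A \<in> sets borel" and "\<And>x. indicator A x \<le> (a + b * x) + c * (x\<^sup>2 - 1)\<^sup>2" for A a b c
    proof -
      have "prob A = expectation (indicator A)" using that(1) by simp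
      also have "\<dots> \<le> expectation (\<lambda>x. (a + b * x) + c * (x\<^sup>2 - 1)\<^sup>2)"
        using that q(1) by (intro integral_mono) (auto simp: emeasure_eq_measure)
      finally show ?thesis using q(2) m4 by simp
    qed
    have out: "prob {x. 1 + \<epsilon> \<le> \<bar>x\<bar>} \<le> \<epsilon>"
    proof -
      have "prob {x. 1 + \<epsilon> \<le> \<bar>x\<bar>} \<le> 0 + (1 / \<epsilon>\<^sup>2) * \<delta>"
        by (rule le[of _ _ 0]) (use indicator_outside_le[OF \<epsilon>(1)] in auto)
      then show ?thesis using d \<epsilon>(1) by linarith
    qed
    \<comment> \<open>The linear part (1 - x) / 2 is 1 at the atom -1 and 0 at the atom 1; its mean
      is 1/2 because \<open>M\<close> is centred. The bound for the other half is the mirror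
      image.\<close>
    have half1: "prob {..1 - \<epsilon>} \<le> 1 / 2 + \<epsilon>"
    proof -
      have "prob {..1 - \<epsilon>} \<le> (1 / 2 + \<epsilon>\<^sup>2 / 16) + (1 / \<epsilon>\<^sup>2) * \<delta>"
        by (rule le[of _ _ "- 1 / 2"])
           (use indicator_le_quartic[OF \<epsilon>(1)] in \<open>auto simp: diff_divide_distrib algebra_simps\<close>)
      then show ?thesis using d e2 \<epsilon>(1) by linarith
    qed
    have half2: "prob {-1 + \<epsilon>..} \<le> 1 / 2 + \<epsilon>"
    proof -
      have "indicator {-1 + \<epsilon>..} x = (indicator {..1 - \<epsilon>} (- x) :: real)" for x
        by (auto split: split_indicator)
      then have "prob {-1 + \<epsilon>..} \<le> (1 / 2 + \<epsilon>\<^sup>2 / 16) + (1 / \<epsilon>\<^sup>2) * \<delta>"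
        by (intro le[of _ _ "1 / 2"])
           (use indicator_le_quartic[OF \<epsilon>(1), of "- x" for x] in
             \<open>auto simp: add_divide_distrib algebra_simps\<close>)
      then show ?thesis using d e2 \<epsilon>(1) by linarith
    qed
    \<comment> \<open>\<open>F1\<close> and \<open>F2\<close> are the upper bounds where the
      Bernoulli distribution function is 0 and at most 1/2; \<open>F3\<close> and \<open>F4\<close>
      are the lower bounds where it is at least 1/2 and equal to 1.\<close>
    have F1: "distfun M (x - \<epsilon>) \<le> \<epsilon>" if "x < -1" for x
      unfolding distfun_def
      by (rule order_trans[OF finite_measure_mono out]) (use that \<epsilon> in auto)
    have F2: "distfun M (x - \<epsilon>) \<le> 1 / 2 + \<epsilon>" if "x < 1" for x
      unfolding distfun_def
      by (rule order_trans[OF finite_measure_mono half1]) (use that \<epsilon> in auto)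
    have F3: "1 / 2 - \<epsilon> \<le> distfun M (x + \<epsilon>)" if "-1 \<le> x" for x
    proof -
      have "1 - prob {-1 + \<epsilon>..} = prob {..< -1 + \<epsilon>}"
        by (subst prob_compl[symmetric]) (auto intro!: arg_cong[where f = prob])
      also have "\<dots> \<le> distfun M (x + \<epsilon>)"
        unfolding distfun_def by (rule finite_measure_mono) (use that in auto)
      finally show ?thesis using half2 by linarith
    qed
    have F4: "1 - \<epsilon> \<le> distfun M (x + \<epsilon>)" if "1 \<le> x" for x
    proof -
      have "1 - prob {x. 1 + \<epsilon> \<le> \<bar>x\<bar>} = prob (space M - {x. 1 + \<epsilon> \<le> \<bar>x\<bar>})"
        by (subst prob_compl) auto
      also have "\<dots> \<le> distfun M (x + \<epsilon>)"
        unfolding distfun_def by (rule finite_measure_mono) (use that in auto)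
      finally show ?thesis using out by linarith
    qed
    have le1: "distfun M t \<le> 1" "0 \<le> distfun M t" for t
      by (simp_all add: distfun_def)
    have "distfun M (x - \<epsilon>) - \<epsilon> \<le> distfun bernoulli_b x \<and>
        distfun bernoulli_b x \<le> distfun M (x + \<epsilon>) + \<epsilon>" for x
      unfolding distfun_bernoulli_b
      using F1[of x] F2[of x] F3[of x] F4[of x] le1(1)[of "x - \<epsilon>"] le1(2)[of "x + \<epsilon>"] \<epsilon>(1)
      by (auto; linarith)
    then show ?thesis unfolding S_def using \<epsilon>(1) by blast
  qed
  have bdd: "bdd_below S"
    by (rule bdd_belowI[of _ 0]) (auto simp: S_def)
  \<comment> \<open>If \<delta> = 0 the bound itself is 0 and is not in \<open>S\<close>, which
    contains only positive numbers; so it is approached from above.\<close>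
  have "Inf S \<le> 7 / 2 * root 3 \<delta> + e" if "0 < e" for e
    using \<delta> that by (intro cInf_lower[OF mem bdd]) (auto simp: add_nonneg_pos)
  then have "Inf S \<le> 7 / 2 * root 3 \<delta>"
    by (rule field_le_epsilon)
  then show ?thesis by (simp add: levy_dist_def S_def)
qed

end

theorem theorem1:
  fixes \<mu> :: "real measure"
  assumes "borel_prob \<mu>"
    and "integrable \<mu> (\<lambda>x. x ^ 4)"
    and "moment 1 \<mu> = 0"
    and "moment 2 \<mu> = 1"
    and "n \<ge> 1"
  shows "levy_dist (dilation (1 / sqrt (real n)) (boolean_pow \<mu> n)) bernoulli_b
           \<le> 7 / 2 * root 3 ((moment 4 \<mu> - 1) / real n)"
proof -
  interpret \<mu>: real_distribution \<mu>
    using assms(1) by (simp add: borel_prob_iff_real_distribution)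
  have "(\<integral>x. x \<partial>\<mu>) = 0" "(\<integral>x. x\<^sup>2 \<partial>\<mu>) = 1"
    using assms(3,4) by (simp_all add: moment_def)
  note lim = \<mu>.axis_cumulant_expansion[OF assms(2) this, folded moment_def]
  let ?N = "boolean_pow \<mu> n"
  note N = \<mu>.boolean_pow_characterization[OF lim(1) assms(5)]
  interpret N: real_distribution ?N using N by simp
  have "axis_cumulant ?N y = of_real (real n) * axis_cumulant \<mu> y" if "0 < y" for y
    using N that by (simp add: axis_cumulant_def)
  \<comment> \<open>Applied with c = n and d = m4(\<mu>) - 1: variance n and fourth moment n
    (m4(\<mu>) - 1) + n^2. The dilation divides these by n and n^2, leaving 1 and 1 + (m4(\<mu>) -
    1) / n.\<close>
  note m = N.moments_from_axis_cumulant[OF this lim]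
  define a where "a = 1 / sqrt (real n)"
  let ?D = "dilation a ?N"
  have a: "a\<^sup>2 = 1 / real n" "a ^ 4 = 1 / (real n)\<^sup>2"
  proof -
    show a2: "a\<^sup>2 = 1 / real n" by (simp add: a_def power_divide)
    have "a ^ 4 = (a\<^sup>2)\<^sup>2" by simp
    then show "a ^ 4 = 1 / (real n)\<^sup>2" by (simp add: a2 power_divide)
  qed
  have D: "real_distribution ?D"
    unfolding dilation_def by (rule N.real_distribution_distr) simp
  have int: "(\<integral>x. x ^ k \<partial>?D) = a ^ k * (\<integral>x. x ^ k \<partial>?N)" for k
    unfolding dilation_def by (subst integral_distr) (auto simp: power_mult_distrib)
  have "levy_dist ?D bernoulli_b \<le> 7 / 2 * root 3 ((moment 4 \<mu> - 1) / real n)"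
  proof (rule real_distribution.levy_dist_bernoulli_le[OF D])
    show "integrable ?D (\<lambda>x. x ^ 4)"
      unfolding dilation_def using m(3)
      by (subst integrable_distr_eq) (auto simp: power_mult_distrib has_bochner_integral_iff)
    show "(\<integral>x. x \<partial>?D) = 0"
      using int[of 1] m(1) by simp
    show "(\<integral>x. x\<^sup>2 \<partial>?D) = 1"
      using int[of 2] m(2) assms(5) by (simp add: a has_bochner_integral_iff)
    show "(\<integral>x. x ^ 4 \<partial>?D) = 1 + (moment 4 \<mu> - 1) / real n"
    proof -
      have "real n \<noteq> 0" using assms(5) by simp
      moreover have "integral\<^sup>L ?N (\<lambda>x. x ^ 4) = real n * (moment 4 \<mu> - 1) + (real n)\<^sup>2"
        using m(3) by (rule has_bochner_integral_integral_eq)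
      ultimately show ?thesis
        unfolding int a by (simp add: power2_eq_square field_simps)
    qed
  qed
  then show ?thesis by (simp add: a_def)
qed

end
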